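(* Let $p$ be a monic polynomial of degree $n$ over $\mathbb{C}$, and let $K$ be any measurable subset of the plane $\mathbb{C}$. Define the multiplicity $n(z,p,K)$ to be the number of $p$-preimages of $z$ in $K$, counted according to their valency. Then the area of $p(K)$ counted with multiplicity satisfies \[ \int_{\mathbb{C}} n(z,p,K)\, d\mathrm{A}(z) \;=\; \int_K |p'(z)|^2 \, d\mathrm{A}(z) \;\ge\; n\pi \left(\frac{\mathrm{Area}(K)}{\pi}\right)^n , \] with equality (in the last inequality) if and only if $K$ is (up to sets of measure zero) a disc and $p$ has a unique critical point at the center of that disc.
   Context: $\mathrm{Area}$ and $d\mathrm{A}$ denote two-dimensional Lebesgue measure on $\mathbb{C}$. The valency of $p$ at a point $w$ is the order of vanishing of $p(\cdot) - p(w)$ at $w$. A critical point of $p$ is a point $z_0$ with $p'(z_0) = 0$.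
   Formalization: The equality characterization is stated for n ≥ 2 and 0 < Area(K) < ∞ (discs of positive radius); otherwise it fails, since equality then always holds, e.g. for n = 1, for K of area zero, or for K = ℂ. *)

theory Defs
  imports "HOL-Analysis.Analysis" "HOL-Computational_Algebra.Polynomial"
begin

definition valency :: "complex poly \<Rightarrow> complex \<Rightarrow> nat" where
  "valency p w = order w (p - [:poly p w:])"

text \<open>
  For non-constant \<open>p\<close> the index set below is finite. For constant \<open>p\<close> valencies are not
  defined; the value at the single point of the range of \<open>p\<close> is then immaterial for
  integrals over the plane.
\<close>

definition preimage_mult :: "complex \<Rightarrow> complex poly \<Rightarrow> complex set \<Rightarrow> nat" where
  "preimage_mult z p K = (\<Sum>w\<in>{w \<in> K. poly p w = z}. valency p w)"

definition critical_points :: "complex poly \<Rightarrow> complex set" where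
  "critical_points p = {z. poly (pderiv p) z = 0}"

definition ae_disc :: "complex set \<Rightarrow> complex \<Rightarrow> real \<Rightarrow> bool" where
  "ae_disc K c r \<longleftrightarrow> 0 < r \<and> sym_diff K (ball c r) \<in> null_sets lebesgue"

end

theory Submission
  imports Defs "HOL-Complex_Analysis.Complex_Analysis"
    "HOL-Computational_Algebra.Fundamental_Theorem_Algebra"
begin

text \<open>
  By the layer cake formula, the integral of \<open>\<bar>p'\<bar>\<^sup>2 = n\<^sup>2 \<bar>q\<bar>\<^sup>2\<close> over \<open>K\<close>, with \<open>q\<close> monic of
  degree \<open>m = n - 1\<close>, is bounded below once the areas of the sets \<open>\<bar>q\<bar>\<^sup>2 \<le> s\<close> are bounded above.
  The bound \<open>\<pi> * root m s\<close> on the latter is an inequality of Polya. It is obtained from the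
  Ahlfors-Beurling bound \<open>\<bar>F\<bar> \<le> sqrt (\<pi> A)\<close> for the Cauchy transform \<open>F\<close> of a set \<open>E\<close> of area
  \<open>A\<close>: for \<open>E = {\<bar>q\<bar> \<le> \<rho> ^ m}\<close>, apply the maximum principle to \<open>F ^ m * q\<close> off \<open>E\<close>, whose
  value at infinity is \<open>A ^ m\<close>. In the case of equality, Polya's inequality must be sharp for
  almost all small \<open>s\<close>, which is impossible if \<open>q\<close> has two different roots, because then the
  areas are of smaller order as \<open>s\<close> tends to zero.
\<close>

subsection \<open>The Ahlfors-Beurling inequality\<close>

text \<open>Tonelli for the indicator of \<open>0 < s < g x\<close> on pairs \<open>(s, x)\<close>
  with \<open>x\<close> in \<open>K\<close>: the integral over \<open>s\<close> at fixed
  \<open>x\<close> is the length of \<open>{0<..<g x}\<close>, which is \<open>ennreal (g x)\<close>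
  also for negative \<open>g x\<close>. The second conclusion permits an almost-everywhere
  comparison of integrands in \<open>s\<close> in the case of equality.\<close>

lemma
  fixes g :: "'a \<Rightarrow> real"
  assumes "sigma_finite_measure M" and [measurable]: "g \<in> borel_measurable M" "K \<in> sets M"
  shows nn_integral_layer_cake:
      "(\<integral>\<^sup>+x\<in>K. ennreal (g x) \<partial>M) = (\<integral>\<^sup>+s\<in>{0<..}. emeasure M {x\<in>K. s < g x} \<partial>lborel)"
    and borel_measurable_emeasure_superlevel:
      "(\<lambda>s. emeasure M {x\<in>K. s < g x} * indicator {0<..} s) \<in> borel_measurable lborel"
proof -
  interpret M: sigma_finite_measure M by fact
  interpret pair_sigma_finite lborel M
    by (simp add: pair_sigma_finite_def M.sigma_finite_measure_axioms lborel.sigma_finite_measure_axioms)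
  let ?f = "\<lambda>s x. indicator {0<..} s * (indicator K x * (if s < g x then 1 else 0)) :: ennreal"
  have meas: "(\<lambda>(s, x). ?f s x) \<in> borel_measurable (lborel \<Otimes>\<^sub>M M)"
    by measurable
  have inner: "(\<integral>\<^sup>+x. ?f s x \<partial>M) = emeasure M {x\<in>K. s < g x} * indicator {0<..} s" for s
  proof -
    have "{x\<in>K. s < g x} = K \<inter> {x\<in>space M. s < g x}" using sets.sets_into_space[OF assms(3)] by auto
    then have [measurable]: "{x\<in>K. s < g x} \<in> sets M" by simp
    have "(\<integral>\<^sup>+x. ?f s x \<partial>M) = (\<integral>\<^sup>+x. indicator {0<..} s * indicator {x\<in>K. s < g x} x \<partial>M)"
      by (rule nn_integral_cong) (auto simp: indicator_def)
    then show ?thesis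
      by (simp add: nn_integral_cmult_indicator mult.commute)
  qed
  show "(\<lambda>s. emeasure M {x\<in>K. s < g x} * indicator {0<..} s) \<in> borel_measurable lborel"
    using M.borel_measurable_nn_integral[OF meas] by (simp add: inner)
  have "(\<integral>\<^sup>+x\<in>K. ennreal (g x) \<partial>M) = (\<integral>\<^sup>+x. (\<integral>\<^sup>+s. ?f s x \<partial>lborel) \<partial>M)"
  proof (rule nn_integral_cong)
    fix x
    have "(\<integral>\<^sup>+s. ?f s x \<partial>lborel) = (\<integral>\<^sup>+s. indicator K x * indicator {0<..<g x} s \<partial>lborel)"
      by (rule nn_integral_cong) (auto simp: indicator_def)
    also have "\<dots> = indicator K x * emeasure lborel {0<..<g x}"
      by (subst nn_integral_cmult_indicator) auto
    also have "emeasure lborel {0<..<g x} = ennreal (g x)"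
      by (cases "0 \<le> g x") (auto simp: ennreal_neg)
    finally show "ennreal (g x) * indicator K x = (\<integral>\<^sup>+s. ?f s x \<partial>lborel)"
      by (simp add: mult.commute)
  qed
  also have "\<dots> = (\<integral>\<^sup>+s. (\<integral>\<^sup>+x. ?f s x \<partial>M) \<partial>lborel)"
    by (rule Fubini'[OF meas])
  finally show "(\<integral>\<^sup>+x\<in>K. ennreal (g x) \<partial>M) = (\<integral>\<^sup>+s\<in>{0<..}. emeasure M {x\<in>K. s < g x} \<partial>lborel)"
    by (simp add: inner)
qed

section \<open>Areas of discs and the integral of the Cauchy kernel over a set of given area\<close>

lemma sigma_finite_lebesgue: "sigma_finite_measure (lebesgue :: 'a::euclidean_space measure)"
proof
  show "\<exists>A. countable A \<and> A \<subseteq> sets lebesgue \<and> \<Union> A = space lebesgue \<and> (\<forall>a\<in>A. emeasure (lebesgue :: 'a measure) a \<noteq> \<infinity>)"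
    by (rule exI[of _ "range (\<lambda>n::nat. ball 0 (real n))"])
       (use emeasure_lborel_ball_finite[of "0 :: 'a"] in \<open>auto simp: less_top[symmetric] intro: reals_Archimedean2\<close>)
qed

lemma emeasure_lebesgue_ball_complex:
  "0 \<le> r \<Longrightarrow> emeasure lebesgue (ball (c::complex) r) = ennreal (pi * r\<^sup>2)"
  by (simp add: emeasure_ball unit_ball_vol_2)

lemma emeasure_lebesgue_cball_complex:
  "0 \<le> r \<Longrightarrow> emeasure lebesgue (cball (c::complex) r) = ennreal (pi * r\<^sup>2)"
  by (simp add: emeasure_cball unit_ball_vol_2)

text \<open>Inversion carries a half-plane off the origin to a disc. With \<open>v = z - w\<close>,
  both conditions reduce to \<open>s * (cmod v)^2 < Re v * Re \<mu> + Im v * Im \<mu>\<close>; at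
  \<open>v = 0\<close>, where division returns 0, both fail because \<open>s > 0\<close>.\<close>

lemma superlevel_Re_inverse_eq_ball:
  assumes "cmod \<mu> = 1" "0 < s"
  shows "{w. s < Re (\<mu> / (z - w))} = ball (z - \<mu> / of_real (2 * s)) (1 / (2 * s))"
proof (rule set_eqI)
  fix w
  define v where "v = z - w"
  have "(cmod (v - \<mu> / of_real (2 * s)))\<^sup>2 = (cmod v)\<^sup>2 - (Re v * Re \<mu> + Im v * Im \<mu>) / s + (cmod \<mu>)\<^sup>2 / (2 * s)\<^sup>2"
    using assms(2) by (simp add: cmod_power2) (simp add: field_simps power2_eq_square)
  then have eq: "(cmod (v - \<mu> / of_real (2 * s)))\<^sup>2 = (cmod v)\<^sup>2 - (Re v * Re \<mu> + Im v * Im \<mu>) / s + (1 / (2 * s))\<^sup>2"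
    using assms by (simp add: power_divide)
  have "w \<in> ball (z - \<mu> / of_real (2 * s)) (1 / (2 * s)) \<longleftrightarrow> cmod (v - \<mu> / of_real (2 * s)) < 1 / (2 * s)"
    by (simp add: v_def dist_norm algebra_simps)
  also have "\<dots> \<longleftrightarrow> (cmod (v - \<mu> / of_real (2 * s)))\<^sup>2 < (1 / (2 * s))\<^sup>2"
  proof
    assume "cmod (v - \<mu> / of_real (2 * s)) < 1 / (2 * s)"
    then show "(cmod (v - \<mu> / of_real (2 * s)))\<^sup>2 < (1 / (2 * s))\<^sup>2"
      by (rule power_strict_mono) auto
  next
    assume "(cmod (v - \<mu> / of_real (2 * s)))\<^sup>2 < (1 / (2 * s))\<^sup>2"
    then show "cmod (v - \<mu> / of_real (2 * s)) < 1 / (2 * s)"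
      by (rule power2_less_imp_less) (use assms(2) in simp)
  qed
  also have "\<dots> \<longleftrightarrow> s * (cmod v)\<^sup>2 < Re v * Re \<mu> + Im v * Im \<mu>"
  proof -
    have "x - y / s + t < t \<longleftrightarrow> s * x < y" for x y t :: real
      using assms(2) by (simp add: pos_less_divide_eq mult.commute)
    then show ?thesis unfolding eq .
  qed
  also have "\<dots> \<longleftrightarrow> s < Re (\<mu> / v)"
  proof (cases "v = 0")
    case False
    then have "0 < (cmod v)\<^sup>2" by simp
    then show ?thesis
      using assms(2) by (simp add: Re_divide cmod_power2 field_simps)
  qed (use assms in auto)
  finally show "w \<in> {w. s < Re (\<mu> / (z - w))} \<longleftrightarrow> w \<in> ball (z - \<mu> / of_real (2 * s)) (1 / (2 * s))"
    by (simp add: v_def)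
qed

lemma nn_integral_inverse_square_tail:
  assumes "0 < (c::real)" "0 \<le> b"
  shows "(\<integral>\<^sup>+s\<in>{c..}. ennreal (b / s\<^sup>2) \<partial>lborel) = ennreal (b / c)"
proof -
  have "(\<integral>\<^sup>+s\<in>{c..}. ennreal (b / s\<^sup>2) \<partial>lborel) = ennreal (0 - (- b / c))"
  proof (rule nn_integral_FTC_atLeast)
    show "DERIV (\<lambda>s. - b / s) s :> b / s\<^sup>2" if "c \<le> s" for s
      using that assms by (auto intro!: derivative_eq_intros simp: power2_eq_square)
    show "((\<lambda>s. - b / s) \<longlongrightarrow> 0) at_top"
      by real_asymp
  qed (use assms in auto)
  then show ?thesis by simp
qed

text \<open>The layer cake formula reduces this to areas of superlevel sets in \<open>E\<close>. At
  level \<open>s\<close> such an area is at most \<open>A\<close> and at most the area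
  \<open>pi / (4 s^2)\<close> of the disc of the previous inversion; integrating the smaller bound
  gives the claim.\<close>

lemma nn_integral_Re_cauchy_kernel_le:
  assumes "cmod \<mu> = 1" and E[measurable]: "E \<in> lmeasurable"
  shows "(\<integral>\<^sup>+w\<in>E. ennreal (Re (\<mu> / (z - w))) \<partial>lebesgue) \<le> ennreal (sqrt (pi * measure lebesgue E))"
proof (cases "measure lebesgue E = 0")
  case True
  then have "E \<in> null_sets lebesgue"
    using E by (intro null_setsI) (auto simp: emeasure_eq_measure2)
  then show ?thesis
    using nn_integral_null_set[of E lebesgue] by simp
next
  case False
  define A where "A = measure lebesgue E"
  have A: "0 < A" "emeasure lebesgue E = ennreal A"
    using False E by (simp_all add: A_def zero_less_measure_iff emeasure_eq_measure2)
  \<comment> \<open>The level at which the bounds \<open>A\<close> and \<open>pi / (4 s^2)\<close>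
    coincide.\<close>
  define c where "c = sqrt (pi / A) / 2"
  have c: "0 < c" using A by (simp add: c_def)
  have [measurable]: "(\<lambda>w. Re (\<mu> / (z - w))) \<in> borel_measurable lebesgue"
    by (rule measurable_completion) measurable
  have Es: "E \<in> sets lebesgue" using E by auto
  have "(\<integral>\<^sup>+w\<in>E. ennreal (Re (\<mu> / (z - w))) \<partial>lebesgue)
      = (\<integral>\<^sup>+s\<in>{0<..}. emeasure lebesgue {w\<in>E. s < Re (\<mu> / (z - w))} \<partial>lborel)"
    by (rule nn_integral_layer_cake) (auto simp: sigma_finite_lebesgue Es)
  \<comment> \<open>The bound \<open>A\<close> serves up to \<open>c\<close> and the disc bound from
    \<open>c\<close> on; the overlap at \<open>c\<close> is harmless for an upper estimate.\<close>
  also have "\<dots> \<le> (\<integral>\<^sup>+s. ennreal A * indicator {0..c} s + ennreal (pi / 4 / s\<^sup>2) * indicator {c..} s \<partial>lborel)"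
  proof (rule nn_integral_mono)
    fix s :: real
    have split: "x * indicator {0<..} s \<le> a * indicator {0..c} s + b * indicator {c..} s"
      if "x \<le> a" "0 < s \<Longrightarrow> x \<le> b" for x a b :: ennreal
      using that by (auto simp: indicator_def intro: add_increasing2)
    have "emeasure lebesgue {w\<in>E. s < Re (\<mu> / (z - w))} \<le> ennreal A"
      using A by (metis (no_types, lifting) Es emeasure_mono mem_Collect_eq subsetI)
    moreover have "emeasure lebesgue {w\<in>E. s < Re (\<mu> / (z - w))} \<le> ennreal (pi / 4 / s\<^sup>2)" if "0 < s"
    proof -
      have "emeasure lebesgue {w\<in>E. s < Re (\<mu> / (z - w))} \<le> emeasure lebesgue (ball (z - \<mu> / of_real (2 * s)) (1 / (2 * s)))"
        using superlevel_Re_inverse_eq_ball[OF assms(1) that, of z] by (intro emeasure_mono) auto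
      also have "\<dots> = ennreal (pi / 4 / s\<^sup>2)"
        using that by (subst emeasure_lebesgue_ball_complex) (auto simp: field_simps power2_eq_square)
      finally show ?thesis .
    qed
    ultimately show "emeasure lebesgue {w\<in>E. s < Re (\<mu> / (z - w))} * indicator {0<..} s
        \<le> ennreal A * indicator {0..c} s + ennreal (pi / 4 / s\<^sup>2) * indicator {c..} s"
      by (rule split)
  qed
  also have "\<dots> = ennreal (A * c) + ennreal (pi / 4 / c)"
  proof -
    have "(\<integral>\<^sup>+s\<in>{c..}. ennreal (pi / 4 / s\<^sup>2) \<partial>lborel) = ennreal (pi / 4 / c)"
      by (rule nn_integral_inverse_square_tail) (use c in auto)
    moreover have "(\<integral>\<^sup>+s. ennreal A * indicator {0..c} s \<partial>lborel) = ennreal (A * c)"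
      using c A by (simp add: nn_integral_cmult_indicator ennreal_mult)
    moreover have "(\<integral>\<^sup>+s. ennreal A * indicator {0..c} s + ennreal (pi / 4 / s\<^sup>2) * indicator {c..} s \<partial>lborel)
        = (\<integral>\<^sup>+s. ennreal A * indicator {0..c} s \<partial>lborel) + (\<integral>\<^sup>+s\<in>{c..}. ennreal (pi / 4 / s\<^sup>2) \<partial>lborel)"
      by (rule nn_integral_add) measurable
    ultimately show ?thesis by simp
  qed
  also have "\<dots> = ennreal (A * c + pi / 4 / c)"
    using c A by simp
  also have "A * c + pi / 4 / c = sqrt (pi * A)"
  proof -
    have "a * a * (q / (2 * a)) + q * q / 4 / (q / (2 * a)) = q * a" if "0 < a" "0 < q" for a q :: real
      using that by (simp add: field_simps)
    from this[of "sqrt A" "sqrt pi"] show ?thesis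
      using A by (simp add: c_def real_sqrt_divide real_sqrt_mult mult.commute)
  qed
  finally show ?thesis by (simp add: A_def)
qed

text \<open>Multiplication by a suitable unimodular \<open>\<mu>\<close> turns the integral into its
  modulus, so the bound on the real part of the rotated kernel applies.\<close>

lemma ahlfors_beurling:
  assumes E: "E \<in> lmeasurable" and int: "set_integrable lebesgue E (\<lambda>w. 1 / (z - w))"
  shows "cmod (LINT w:E|lebesgue. 1 / (z - w)) \<le> sqrt (pi * measure lebesgue E)"
proof -
  define I where "I = (LINT w:E|lebesgue. 1 / (z - w))"
  define \<mu> where "\<mu> = (if I = 0 then 1 else cnj (sgn I))"
  have \<mu>: "cmod \<mu> = 1" by (simp add: \<mu>_def norm_sgn)
  have "of_real (cmod I) = \<mu> * I"
  proof (cases "I = 0")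
    case False
    then have "\<mu> * I = of_real ((cmod I)\<^sup>2) / of_real (cmod I)"
      unfolding complex_norm_square by (simp add: \<mu>_def sgn_eq)
    then show ?thesis using False by (simp add: power2_eq_square)
  qed (simp add: \<mu>_def)
  then have "cmod I = Re (\<mu> * I)" by (metis Re_complex_of_real)
  also have "\<mu> * I = (LINT w:E|lebesgue. \<mu> / (z - w))"
    using int by (simp add: I_def flip: set_integral_mult_right)
  also have "Re \<dots> = (LINT w:E|lebesgue. Re (\<mu> / (z - w)))"
  proof -
    have "set_integrable lebesgue E (\<lambda>w. \<mu> / (z - w))"
      using set_integrable_mult_right[OF int, of \<mu>] by simp
    then show ?thesis
      unfolding set_lebesgue_integral_def set_integrable_def by (subst integral_Re[symmetric]) auto
  qed
  \<comment> \<open>A real integral is the integral of the positive part minus that of the negative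
    part; \<open>ennreal\<close> truncates at zero and keeps only the former.\<close>
  also have "\<dots> \<le> enn2real (\<integral>\<^sup>+w. ennreal (indicator E w *\<^sub>R Re (\<mu> / (z - w))) \<partial>lebesgue)"
  proof -
    have "set_integrable lebesgue E (\<lambda>w. \<mu> / (z - w))"
      using set_integrable_mult_right[OF int, of \<mu>] by simp
    then have "integrable lebesgue (\<lambda>w. indicator E w *\<^sub>R Re (\<mu> / (z - w)))"
      unfolding set_integrable_def using integrable_Re by fastforce
    then show ?thesis
      unfolding set_lebesgue_integral_def by (simp add: real_lebesgue_integral_def)
  qed
  also have "(\<integral>\<^sup>+w. ennreal (indicator E w *\<^sub>R Re (\<mu> / (z - w))) \<partial>lebesgue) = (\<integral>\<^sup>+w\<in>E. ennreal (Re (\<mu> / (z - w))) \<partial>lebesgue)"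
    by (rule nn_integral_cong) (auto simp: indicator_def)
  also have "enn2real \<dots> \<le> sqrt (pi * measure lebesgue E)"
    by (rule enn2real_leI[OF _ nn_integral_Re_cauchy_kernel_le[OF \<mu> E]]) auto
  finally show ?thesis by (simp add: I_def)
qed

subsection \<open>Area of polynomial lemniscates\<close>

lemma set_integrable_lebesgue_continuous_compact:
  fixes f :: "'a::euclidean_space \<Rightarrow> 'b::{banach, second_countable_topology}"
  assumes "compact S" "continuous_on S f"
  shows "set_integrable lebesgue S f"
proof -
  have *: "integrable lborel (\<lambda>x. indicator S x *\<^sub>R f x)"
    by (rule borel_integrable_compact[OF assms])
  then show ?thesis
    unfolding set_integrable_def
    using integrable_completion[OF borel_measurable_integrable[OF *]] by blast
qed

text \<open>Differentiation under the integral sign: on the compact \<open>E\<close> the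
  denominators stay away from zero, so the error of the difference quotient is \<open>O(h)\<close>
  uniformly in \<open>w\<close>. The variable \<open>u\<close> stands for
  \<open>1 / (z - a)\<close>, with \<open>g w = w - a\<close>, so that infinity becomes the ordinary
  point \<open>u = 0\<close>.\<close>

lemma has_field_derivative_cauchy_transform:
  fixes g :: "complex \<Rightarrow> complex"
  assumes E: "compact E" and g: "continuous_on E g" and nz: "\<And>w. w \<in> E \<Longrightarrow> 1 - u * g w \<noteq> 0"
  shows "((\<lambda>u. LINT w:E|lebesgue. 1 / (1 - u * g w)) has_field_derivative
           (LINT w:E|lebesgue. g w / (1 - u * g w)\<^sup>2)) (at u)"
proof -
  define F where "F = (\<lambda>u. LINT w:E|lebesgue. 1 / (1 - u * g w))"
  define D where "D = (LINT w:E|lebesgue. g w / (1 - u * g w)\<^sup>2)"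
  have Elm: "E \<in> lmeasurable" by (rule lmeasurable_compact[OF E])
  obtain b where b: "0 < b" "\<And>w. w \<in> E \<Longrightarrow> cmod (g w) \<le> b"
    using compact_imp_bounded[OF compact_continuous_image[OF g E]] by (auto simp: bounded_pos)
  obtain d where d: "0 < d" "\<And>w. w \<in> E \<Longrightarrow> d \<le> cmod (1 - u * g w)"
  proof -
    have "compact ((\<lambda>w. 1 - u * g w) ` E)"
      by (intro compact_continuous_image E continuous_intros g)
    moreover have "0 \<notin> (\<lambda>w. 1 - u * g w) ` E" using nz by force
    ultimately obtain d where "0 < d" "\<And>x. x \<in> (\<lambda>w. 1 - u * g w) ` E \<Longrightarrow> d \<le> dist 0 x"
      using separate_point_closed[OF compact_imp_closed] by metis
    then show ?thesis by (intro that[of d]) auto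
  qed
  \<comment> \<open>Bounds \<open>(cmod (g w))^2\<close> over the three denominators that remain in
    the error term, two of size at least \<open>d\<close> and one of size at least
    \<open>d / 2\<close>.\<close>
  define C where "C = b\<^sup>2 / (d\<^sup>2 * (d / 2))"
  \<comment> \<open>Moving \<open>u\<close> by at most \<open>d / (2 * b)\<close> changes
    \<open>u * g w\<close> by at most \<open>d / 2\<close>, which leaves half of the margin
    \<open>d\<close>.\<close>
  have near: "d / 2 \<le> cmod (1 - v * g w)" if "cmod (v - u) \<le> d / (2 * b)" "w \<in> E" for v w
  proof -
    have "cmod ((v - u) * g w) \<le> d / (2 * b) * b"
      unfolding norm_mult using that b d(1) by (intro mult_mono) auto
    then have "cmod ((v - u) * g w) \<le> d / 2" using b by simp
    moreover have "1 - u * g w = (1 - v * g w) + (v - u) * g w" by (simp add: algebra_simps)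
    then have "cmod (1 - u * g w) \<le> cmod (1 - v * g w) + cmod ((v - u) * g w)"
      using norm_triangle_ineq by metis
    ultimately show ?thesis using d(2)[OF that(2)] by linarith
  qed
  have int: "set_integrable lebesgue E (\<lambda>w. 1 / (1 - v * g w))" if "cmod (v - u) \<le> d / (2 * b)" for v
  proof (intro set_integrable_lebesgue_continuous_compact E continuous_intros g ballI)
    show "1 - v * g w \<noteq> 0" if "w \<in> E" for w
      using near[OF \<open>cmod (v - u) \<le> d / (2 * b)\<close> that] d(1) by auto
  qed
  have intD: "set_integrable lebesgue E (\<lambda>w. g w / (1 - u * g w)\<^sup>2)"
    using nz by (intro set_integrable_lebesgue_continuous_compact E continuous_intros g) auto
  have quot: "cmod ((F (u + h) - F u) / h - D) \<le> cmod h * (C * measure lebesgue E)"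
    if h: "h \<noteq> 0" "cmod h \<le> d / (2 * b)" for h
  proof -
    have i1: "set_integrable lebesgue E (\<lambda>w. 1 / (1 - (u + h) * g w))" by (rule int) (use h in auto)
    have i2: "set_integrable lebesgue E (\<lambda>w. 1 / (1 - u * g w))" by (rule int) (use d b in auto)
    let ?k = "\<lambda>w. (1 / (1 - (u + h) * g w) - 1 / (1 - u * g w)) / h - g w / (1 - u * g w)\<^sup>2"
    have i3: "set_integrable lebesgue E ?k"
      by (intro set_integral_diff set_integrable_divide i1 i2 intD)
    have "(F (u + h) - F u) / h - D = (LINT w:E|lebesgue. ?k w)"
      unfolding F_def D_def
      by (simp only: set_integral_diff set_integrable_divide i1 i2 intD set_integral_divide_zero)
    also have "cmod \<dots> \<le> (LINT w:E|lebesgue. cmod h * C)"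
    proof -
      have kb: "cmod (?k w) \<le> cmod h * C" if "w \<in> E" for w
      proof -
        have n1: "1 - (u + h) * g w \<noteq> 0" using near[of "u + h" w] h that d(1) by force
        have n2: "1 - u * g w \<noteq> 0" using nz that by blast
        have "1 / (1 - (u + h) * g w) - 1 / (1 - u * g w) = h * g w / ((1 - (u + h) * g w) * (1 - u * g w))"
          using n1 n2 by (simp add: divide_simps) (simp add: algebra_simps)
        then have "?k w = g w / ((1 - (u + h) * g w) * (1 - u * g w)) - g w / (1 - u * g w)\<^sup>2"
          using h by simp
        also have "\<dots> = h * (g w)\<^sup>2 / ((1 - u * g w)\<^sup>2 * (1 - (u + h) * g w))"
          using n1 n2 by (simp add: divide_simps) (simp add: algebra_simps power2_eq_square)
        also have "cmod \<dots> = cmod h * ((cmod (g w))\<^sup>2 / ((cmod (1 - u * g w))\<^sup>2 * cmod (1 - (u + h) * g w)))"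
          by (simp add: norm_mult norm_divide norm_power)
        also have "\<dots> \<le> cmod h * C"
          unfolding C_def using b d near[of "u + h" w] h that
          by (intro mult_left_mono frac_le mult_mono power_mono mult_pos_pos) auto
        finally show ?thesis .
      qed
      show ?thesis
        unfolding set_lebesgue_integral_def
      proof (rule order_trans[OF integral_norm_bound integral_mono])
        show "integrable lebesgue (\<lambda>w. norm (indicator E w *\<^sub>R ?k w))"
          using i3 unfolding set_integrable_def by (rule integrable_norm)
        show "integrable lebesgue (\<lambda>w. indicator E w *\<^sub>R (cmod h * C))"
          using Elm by (intro integrable_scaleR_left integrable_real_indicator) (auto simp: fmeasurable_def)
        show "norm (indicat_real E w *\<^sub>R ?k w) \<le> indicat_real E w *\<^sub>R (cmod h * C)" for w
          using kb[of w] by (auto simp: indicator_def)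
      qed
    qed
    also have "\<dots> = cmod h * (C * measure lebesgue E)"
      using Elm by (simp add: set_lebesgue_integral_def)
    finally show ?thesis .
  qed
  have "((\<lambda>h. (F (u + h) - F u) / h - D) \<longlongrightarrow> 0) (at 0)"
  proof (rule Lim_null_comparison)
    show "\<forall>\<^sub>F h in at 0. norm ((F (u + h) - F u) / h - D) \<le> cmod h * (C * measure lebesgue E)"
      unfolding eventually_at using quot b d by (intro exI[of _ "d / (2 * b)"]) auto
    show "((\<lambda>h. cmod h * (C * measure lebesgue E)) \<longlongrightarrow> 0) (at 0)"
      by (auto intro!: tendsto_eq_intros)
  qed
  then have "(F has_field_derivative D) (at u)"
    unfolding DERIV_def by (rule LIM_zero_cancel)
  then show ?thesis unfolding F_def D_def .
qed

section \<open>Compactness of lemniscates and Polya's area bound\<close>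

lemma lemniscate_subset_balls:
  fixes r :: "nat \<Rightarrow> complex"
  assumes "0 < m" "0 \<le> \<rho>"
  shows "{z. cmod (\<Prod>i<m. z - r i) \<le> \<rho> ^ m} \<subseteq> (\<Union>i<m. cball (r i) \<rho>)"
proof (rule subsetI, rule ccontr)
  fix z assume z: "z \<in> {z. cmod (\<Prod>i<m. z - r i) \<le> \<rho> ^ m}" "z \<notin> (\<Union>i<m. cball (r i) \<rho>)"
  then have far: "\<rho> < cmod (z - r i)" if "i < m" for i
    using that by (auto simp: dist_norm norm_minus_commute not_le)
  \<comment> \<open>All factors exceed \<open>\<rho>\<close>, and there is at least one factor, so
    the product exceeds \<open>\<rho> ^ m\<close> strictly.\<close>
  then have "(\<Prod>i<m. \<rho>) < (\<Prod>i<m. cmod (z - r i))"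
    using assms far by (intro prod_mono_strict) (force intro: less_imp_le order.strict_trans1)+
  then show False using z(1) by (simp add: prod_norm)
qed

lemma compact_lemniscate:
  fixes r :: "nat \<Rightarrow> complex"
  assumes "0 < m" "0 \<le> \<rho>"
  shows "compact {z. cmod (\<Prod>i<m. z - r i) \<le> \<rho> ^ m}"
proof -
  have "bounded (\<Union>i<m. cball (r i) \<rho>)" by auto
  then have "bounded {z. cmod (\<Prod>i<m. z - r i) \<le> \<rho> ^ m}"
    using bounded_subset lemniscate_subset_balls[OF assms] by blast
  moreover have "closed {z. cmod (\<Prod>i<m. z - r i) \<le> \<rho> ^ m}"
    by (intro closed_Collect_le continuous_intros)
  ultimately show ?thesis by (simp add: compact_eq_bounded_closed)
qed

text \<open>In the coordinate \<open>u = 1 / (z - a)\<close>, the function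
  \<open>F u ^ m * Q u\<close> is the m-th power of the Cauchy transform of \<open>E\<close> times
  the polynomial, and equals \<open>A ^ m\<close> at \<open>u = 0\<close>. The maximum principle on
  \<open>S\<close> compares this value with the Ahlfors-Beurling bound on the frontier. The gap
  between \<open>\<rho>\<close> and \<open>\<rho>'\<close> keeps the closed set \<open>S\<close>
  clear of the poles coming from \<open>E\<close>.\<close>

lemma lemniscate_area_aux:
  fixes r :: "nat \<Rightarrow> complex"
  assumes m: "0 < m" and \<rho>: "0 \<le> \<rho>" "\<rho> < \<rho>'"
  defines "A \<equiv> measure lebesgue {z. cmod (\<Prod>i<m. z - r i) \<le> \<rho> ^ m}"
  shows "A \<le> sqrt (pi * A) * \<rho>'"
proof -
  define E where "E = {z. cmod (\<Prod>i<m. z - r i) \<le> \<rho> ^ m}"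
  \<comment> \<open>A root as centre of the inversion: the polynomial is small near it, so large
    \<open>u\<close> do not lie in \<open>S\<close>, and \<open>S\<close> is bounded.\<close>
  define a where "a = r 0"
  \<comment> \<open>For \<open>u \<noteq> 0\<close> this is \<open>u ^ m\<close> times the
    polynomial at \<open>a + 1 / u\<close>; it extends to \<open>u = 0\<close> with value 1.\<close>
  define Q where "Q = (\<lambda>u. \<Prod>i<m. 1 - u * (r i - a))"
  define F where "F = (\<lambda>u. LINT w:E|lebesgue. 1 / (1 - u * (w - a)))"
  \<comment> \<open>The image of the region where the polynomial has modulus at least
    \<open>\<rho>' ^ m\<close>, together with \<open>u = 0\<close> for infinity.\<close>
  define S where "S = {u. (\<rho>' * cmod u) ^ m \<le> cmod (Q u)}"
  have A: "A = measure lebesgue E" by (simp add: A_def E_def)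
  have E: "compact E" unfolding E_def using compact_lemniscate[OF m \<rho>(1)] .
  have Elm: "E \<in> lmeasurable" by (rule lmeasurable_compact[OF E])
  have contQ: "continuous_on X Q" for X unfolding Q_def by (intro continuous_intros)
  have Q_inv: "cmod (Q u) = cmod u ^ m * cmod (\<Prod>i<m. a + 1 / u - r i)" if "u \<noteq> 0" for u
  proof -
    have "Q u = (\<Prod>i<m. u * (a + 1 / u - r i))"
      unfolding Q_def using that by (intro prod.cong) (auto simp: field_simps)
    then show ?thesis by (simp add: prod.distrib norm_mult norm_power)
  qed
  have nz: "1 - u * (w - a) \<noteq> 0" if "u \<in> S" "w \<in> E" for u w
  proof
    assume 0: "1 - u * (w - a) = 0"
    then have u: "u \<noteq> 0" by auto
    with 0 have w: "a + 1 / u = w" by (simp add: field_simps)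
    have "cmod (Q u) \<le> cmod u ^ m * \<rho> ^ m"
      unfolding Q_inv[OF u] w using that(2) by (intro mult_left_mono) (auto simp: E_def)
    also have "\<dots> < cmod u ^ m * \<rho>' ^ m"
      using u \<rho> m by (intro mult_strict_left_mono power_strict_mono) auto
    finally show False using that(1) by (simp add: S_def power_mult_distrib mult.commute)
  qed
  have derF: "F field_differentiable (at u)" if "u \<in> S" for u
    unfolding F_def field_differentiable_def
    by (rule exI, rule has_field_derivative_cauchy_transform[OF E]) (use nz[OF that] in \<open>auto intro!: continuous_intros\<close>)
  have closedS: "closed S" unfolding S_def by (intro closed_Collect_le continuous_intros contQ)
  have boundedS: "bounded S"
  proof -
    have "isCont (\<lambda>z. cmod (\<Prod>i<m. z - r i)) a" by (intro continuous_intros)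
    moreover have "cmod (\<Prod>i<m. a - r i) = 0" using m by (auto simp: a_def)
    ultimately have "((\<lambda>z. cmod (\<Prod>i<m. z - r i)) \<longlongrightarrow> 0) (at a)" by (simp add: isCont_def)
    then have "\<forall>\<^sub>F z in at a. cmod (\<Prod>i<m. z - r i) < \<rho>' ^ m"
      using \<rho> by (intro order_tendstoD) auto
    then obtain \<delta> where \<delta>: "0 < \<delta>" "\<And>z. z \<noteq> a \<Longrightarrow> dist z a < \<delta> \<Longrightarrow> cmod (\<Prod>i<m. z - r i) < \<rho>' ^ m"
      unfolding eventually_at by auto
    have "cmod u \<le> 1 / \<delta>" if "u \<in> S" for u
    proof (rule ccontr)
      assume *: "\<not> cmod u \<le> 1 / \<delta>"
      then have u: "u \<noteq> 0" using \<delta> by auto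
      have "cmod (\<Prod>i<m. a + 1 / u - r i) < \<rho>' ^ m"
        using * u \<delta> by (intro \<delta>(2)) (auto simp: dist_norm norm_divide field_simps)
      then have "cmod (Q u) < cmod u ^ m * \<rho>' ^ m"
        unfolding Q_inv[OF u] using u by (intro mult_strict_left_mono) auto
      then show False using that by (simp add: S_def power_mult_distrib mult.commute)
    qed
    then show ?thesis by (auto simp: bounded_iff)
  qed
  have Fbound: "cmod (F u) * cmod u \<le> sqrt (pi * A)" if "u \<in> S" for u
  proof (cases "u = 0")
    case False
    \<comment> \<open>In this coordinate \<open>F u\<close> is the Cauchy transform at
      \<open>z\<close> divided by \<open>u\<close>, which accounts for the factor
      \<open>cmod u\<close> in the bound.\<close>
    define z where "z = a + 1 / u"
    have eq: "1 - u * (w - a) = u * (z - w)" for w using False by (simp add: z_def field_simps)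
    have int_z: "set_integrable lebesgue E (\<lambda>w. 1 / (z - w))"
      using nz[OF that] unfolding eq
      by (intro set_integrable_lebesgue_continuous_compact E continuous_intros) auto
    from ahlfors_beurling[OF Elm int_z]
    have "cmod (LINT w:E|lebesgue. 1 / (z - w)) \<le> sqrt (pi * A)" by (simp add: A)
    moreover have "F u = (LINT w:E|lebesgue. (1 / u) * (1 / (z - w)))"
      unfolding F_def eq by simp
    then have "F u = (1 / u) * (LINT w:E|lebesgue. 1 / (z - w))"
      using int_z by (simp only: set_integral_mult_right)
    ultimately show ?thesis using False by (simp add: norm_divide)
  qed (auto simp: A)
  have F0: "F 0 = of_real A"
    using Elm by (simp add: F_def A set_lebesgue_integral_def scaleR_conv_of_real)
  have "cmod (F 0 ^ m * Q 0) \<le> (sqrt (pi * A) * \<rho>') ^ m"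
  proof (rule maximum_modulus_frontier[where f = "\<lambda>u. F u ^ m * Q u" and S = S])
    show "(\<lambda>u. F u ^ m * Q u) holomorphic_on interior S"
      using derF interior_subset[of S] unfolding Q_def
      by (intro holomorphic_intros) (auto simp: holomorphic_on_def intro: field_differentiable_at_within)
    show "continuous_on (closure S) (\<lambda>u. F u ^ m * Q u)"
      using derF closedS
      by (intro continuous_intros contQ continuous_at_imp_continuous_on)
         (auto intro: field_differentiable_imp_continuous_at)
    fix u assume u: "u \<in> frontier S"
    then have uS: "u \<in> S" using closedS by (simp add: frontier_subset_eq[symmetric] frontier_def)
    \<comment> \<open>Strict inequality defines an open subset of \<open>S\<close>, hence interior
      points; on the frontier equality must hold.\<close>
    have "open {u. (\<rho>' * cmod u) ^ m < cmod (Q u)}"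
      by (intro open_Collect_less continuous_intros contQ)
    then have "{u. (\<rho>' * cmod u) ^ m < cmod (Q u)} \<subseteq> interior S"
      by (intro interior_maximal) (auto simp: S_def)
    then have "cmod (Q u) = (\<rho>' * cmod u) ^ m"
      using u uS unfolding frontier_def by (force simp: S_def)
    then have "cmod (F u ^ m * Q u) = (cmod (F u) * cmod u * \<rho>') ^ m"
      by (simp add: norm_mult norm_power power_mult_distrib mult_ac)
    also have "\<dots> \<le> (sqrt (pi * A) * \<rho>') ^ m"
      using Fbound[OF uS] \<rho> by (intro power_mono mult_right_mono) auto
    finally show "cmod (F u ^ m * Q u) \<le> (sqrt (pi * A) * \<rho>') ^ m" .
  next
    show "0 \<in> S" using m by (simp add: S_def zero_power)
  qed (rule boundedS)
  then have "A ^ m \<le> (sqrt (pi * A) * \<rho>') ^ m"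
    by (simp add: F0 Q_def norm_mult norm_power A)
  then show ?thesis
    using m \<rho> by (subst (asm) power_mono_iff) (auto simp: A)
qed

text \<open>Letting \<open>\<rho>'\<close> decrease to \<open>\<rho>\<close> gives
  \<open>A \<le> sqrt (pi * A) * \<rho>\<close>; if \<open>A\<close> is positive, a factor
  \<open>sqrt A\<close> cancels and squaring finishes.\<close>

theorem lemniscate_area_le:
  fixes r :: "nat \<Rightarrow> complex"
  assumes m: "0 < m" and \<rho>: "0 \<le> \<rho>"
  shows "emeasure lebesgue {z. cmod (\<Prod>i<m. z - r i) \<le> \<rho> ^ m} \<le> ennreal (pi * \<rho>\<^sup>2)"
proof -
  define E where "E = {z. cmod (\<Prod>i<m. z - r i) \<le> \<rho> ^ m}"
  define A where "A = measure lebesgue E"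
  have "A \<le> sqrt (pi * A) * \<rho>"
  proof (rule tendsto_lowerbound)
    show "((\<lambda>x. sqrt (pi * A) * x) \<longlongrightarrow> sqrt (pi * A) * \<rho>) (at_right \<rho>)"
      by (intro tendsto_intros)
    show "\<forall>\<^sub>F x in at_right \<rho>. A \<le> sqrt (pi * A) * x"
      using lemniscate_area_aux[OF m \<rho>] eventually_at_right_less[of \<rho>]
      unfolding A_def E_def by (auto elim!: eventually_mono)
  qed auto
  moreover have "0 \<le> A" by (simp add: A_def)
  ultimately have "sqrt A * sqrt A \<le> (sqrt pi * \<rho>) * sqrt A"
    by (simp add: real_sqrt_mult mult_ac)
  with \<open>0 \<le> A\<close> have "sqrt A \<le> sqrt pi * \<rho>"
    using \<rho> by (cases "A = 0") (auto intro: mult_right_le_imp_le[of "sqrt A" "sqrt A"] simp del: real_sqrt_mult_self)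
  then have "(sqrt A)\<^sup>2 \<le> (sqrt pi * \<rho>)\<^sup>2"
    using \<open>0 \<le> A\<close> by (intro power_mono) auto
  then have "A \<le> pi * \<rho>\<^sup>2" using \<open>0 \<le> A\<close> by (simp add: power_mult_distrib)
  then show ?thesis
    using lmeasurable_compact[OF compact_lemniscate[OF m \<rho>, of r]]
    by (simp add: A_def E_def emeasure_eq_measure2 ennreal_leI)
qed

lemma lemniscate_area_root:
  fixes r :: "nat \<Rightarrow> complex"
  assumes m: "0 < m" and s: "0 \<le> s"
  shows "emeasure lebesgue {z. (cmod (\<Prod>i<m. z - r i))\<^sup>2 \<le> s} \<le> ennreal (pi * root m s)"
proof -
  define \<rho> where "\<rho> = sqrt (root m s)"
  have rm: "0 \<le> root m s" using m s by simp
  have "\<rho> ^ m = sqrt s" unfolding \<rho>_def using m s by (simp add: real_sqrt_power[symmetric])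
  moreover have "(cmod (\<Prod>i<m. z - r i))\<^sup>2 \<le> s \<longleftrightarrow> cmod (\<Prod>i<m. z - r i) \<le> sqrt s" for z
    using real_sqrt_le_iff[of "(cmod (\<Prod>i<m. z - r i))\<^sup>2" s] by simp
  moreover have "\<rho>\<^sup>2 = root m s" "0 \<le> \<rho>" using rm by (simp_all add: \<rho>_def)
  ultimately show ?thesis using lemniscate_area_le[OF m, of \<rho> r] by simp
qed

text \<open>A sublevel set of level tending to zero lies in discs whose radii decay like \<open>s\<close> to the
  power \<open>1 / (2 (m - 1))\<close> as soon as there are two different roots.\<close>

lemma lemniscate_area_less:
  fixes r :: "nat \<Rightarrow> complex"
  assumes ne: "i0 < m" "j0 < m" "r i0 \<noteq> r j0"
  obtains \<epsilon> where "0 < \<epsilon>"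
    "\<And>s. 0 < s \<Longrightarrow> s < \<epsilon> \<Longrightarrow> emeasure lebesgue {z. (cmod (\<Prod>i<m. z - r i))\<^sup>2 \<le> s} < ennreal (pi * root m s)"
proof -
  have m: "2 \<le> m" using ne by (cases "i0 = j0") auto
  \<comment> \<open>A quarter of the distance between two distinct roots: every root is then at
    least \<open>2 * \<delta>\<close> away from one of these two.\<close>
  define \<delta> where "\<delta> = dist (r i0) (r j0) / 4"
  have \<delta>: "0 < \<delta>" using ne by (simp add: \<delta>_def)
  \<comment> \<open>Chosen so that a radius \<open>\<tau> < t\<close> satisfies
    \<open>m ^ m * \<tau>^2 < \<delta>^2\<close>; the threshold \<open>\<epsilon>\<close> below
    translates \<open>\<tau> < t\<close> into a condition on \<open>s\<close>.\<close>
  define t where "t = sqrt (\<delta>\<^sup>2 / real m ^ m)"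
  have t: "0 < t" "t\<^sup>2 = \<delta>\<^sup>2 / real m ^ m" using \<delta> m by (simp_all add: t_def)
  define \<epsilon> where "\<epsilon> = (\<delta> * t ^ (m - 1))\<^sup>2"
  have "0 < \<epsilon>" using \<delta> t by (simp add: \<epsilon>_def)
  moreover have "emeasure lebesgue {z. (cmod (\<Prod>i<m. z - r i))\<^sup>2 \<le> s} < ennreal (pi * root m s)"
    if s: "0 < s" "s < \<epsilon>" for s
  proof -
    define \<tau> where "\<tau> = root (m - 1) (sqrt s / \<delta>)"
    have \<tau>: "0 < \<tau>" using s \<delta> m by (simp add: \<tau>_def)
    have \<tau>pow: "\<delta> * \<tau> ^ (m - 1) = sqrt s" using s \<delta> m by (simp add: \<tau>_def)
    \<comment> \<open>Let \<open>r i\<close> be the root nearest to \<open>z\<close>. A root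
      \<open>r j\<close> at distance at least \<open>2 * \<delta>\<close> from it is at least
      \<open>\<delta>\<close> away from \<open>z\<close>, and each of the other \<open>m - 1\<close>
      factors is at least \<open>dist z (r i)\<close>.\<close>
    have sub: "{z. (cmod (\<Prod>i<m. z - r i))\<^sup>2 \<le> s} \<subseteq> (\<Union>i<m. cball (r i) \<tau>)"
    proof
      fix z assume "z \<in> {z. (cmod (\<Prod>i<m. z - r i))\<^sup>2 \<le> s}"
      then have z: "cmod (\<Prod>i<m. z - r i) \<le> sqrt s" by (simp add: real_le_rsqrt)
      define i where "i = arg_min_on (\<lambda>k. dist z (r k)) {..<m}"
      have i: "i < m" "\<And>k. k < m \<Longrightarrow> dist z (r i) \<le> dist z (r k)"
        using arg_min_if_finite[of "{..<m}" "\<lambda>k. dist z (r k)"] m by (force simp: i_def not_less)+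
      obtain j where j: "j < m" "2 * \<delta> \<le> dist (r i) (r j)"
      proof (cases "2 * \<delta> \<le> dist (r i) (r i0)")
        case False
        then have "2 * \<delta> \<le> dist (r i) (r j0)"
          using dist_triangle[of "r i0" "r j0" "r i"] by (simp add: \<delta>_def dist_commute)
        then show ?thesis using that ne by blast
      qed (use that ne in blast)
      have far: "\<delta> \<le> dist z (r j)"
        using dist_triangle[of "r i" "r j" z] i(2)[OF j(1)] j(2) by (simp add: dist_commute)
      have "\<delta> * dist z (r i) ^ (m - 1) \<le> dist z (r j) * (\<Prod>k\<in>{..<m} - {j}. dist z (r k))"
      proof (rule mult_mono[OF far])
        have "dist z (r i) ^ (m - 1) = (\<Prod>k\<in>{..<m} - {j}. dist z (r i))" using j by simp
        also have "\<dots> \<le> (\<Prod>k\<in>{..<m} - {j}. dist z (r k))" using i by (intro prod_mono) auto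
        finally show "dist z (r i) ^ (m - 1) \<le> (\<Prod>k\<in>{..<m} - {j}. dist z (r k))" .
      qed auto
      also have "\<dots> = (\<Prod>k<m. dist z (r k))" using j by (simp add: prod.remove[of _ j])
      also have "\<dots> = cmod (\<Prod>k<m. z - r k)" by (simp add: prod_norm dist_norm)
      also have "\<dots> \<le> \<delta> * \<tau> ^ (m - 1)" using z \<tau>pow by simp
      finally have "dist z (r i) ^ (m - 1) \<le> \<tau> ^ (m - 1)" using \<delta> by simp
      then have "dist z (r i) \<le> \<tau>" using m \<tau> by simp
      then show "z \<in> (\<Union>i<m. cball (r i) \<tau>)" using i(1) by (auto simp: dist_commute)
    qed
    have "emeasure lebesgue {z. (cmod (\<Prod>i<m. z - r i))\<^sup>2 \<le> s} \<le> emeasure lebesgue (\<Union>i<m. cball (r i) \<tau>)"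
      using sub by (intro emeasure_mono) auto
    also have "\<dots> \<le> (\<Sum>i<m. emeasure lebesgue (cball (r i) \<tau>))"
      by (intro emeasure_subadditive_finite) auto
    also have "\<dots> = ennreal (real m * (pi * \<tau>\<^sup>2))"
      unfolding emeasure_lebesgue_cball_complex[OF less_imp_le[OF \<tau>]]
      by (simp add: ennreal_mult ennreal_of_nat_eq_real_of_nat)
    also have "\<dots> < ennreal (pi * root m s)"
    proof -
      \<comment> \<open>From \<open>\<tau> < t\<close>, multiplying
        \<open>m ^ m * \<tau>^2 < \<delta>^2\<close> by the square of
        \<open>\<tau> ^ (m - 1)\<close> yields \<open>(m * \<tau>^2) ^ m < s\<close>, so the total
        area of the \<open>m\<close> discs is below the bound.\<close>
      have "s < (\<delta> * t ^ (m - 1))\<^sup>2" using s(2) by (simp only: \<epsilon>_def)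
      then have "sqrt s < \<delta> * t ^ (m - 1)" using \<delta> t by (intro real_less_lsqrt) auto
      then have "\<tau> ^ (m - 1) < t ^ (m - 1)"
        unfolding \<tau>pow[symmetric] using \<delta> by simp
      then have "\<tau> < t" by (rule power_less_imp_less_base) (use t in simp)
      then have "\<tau>\<^sup>2 < \<delta>\<^sup>2 / real m ^ m"
        unfolding t(2)[symmetric] using \<tau> by (intro power_strict_mono) auto
      then have "real m ^ m * \<tau>\<^sup>2 < \<delta>\<^sup>2" using m by (simp add: field_simps)
      then have "real m ^ m * \<tau>\<^sup>2 * (\<tau> ^ (m - 1))\<^sup>2 < \<delta>\<^sup>2 * (\<tau> ^ (m - 1))\<^sup>2"
        using \<tau> by (intro mult_strict_right_mono) auto
      also have "\<delta>\<^sup>2 * (\<tau> ^ (m - 1))\<^sup>2 = (sqrt s)\<^sup>2"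
        unfolding \<tau>pow[symmetric] by (simp add: power_mult_distrib)
      also have "\<dots> = s" using s by simp
      also have "real m ^ m * \<tau>\<^sup>2 * (\<tau> ^ (m - 1))\<^sup>2 = (real m * \<tau>\<^sup>2) ^ m"
      proof -
        have "\<tau>\<^sup>2 * (\<tau> ^ (m - 1))\<^sup>2 = (\<tau> ^ Suc (m - 1))\<^sup>2" by (simp add: power_mult_distrib)
        also have "\<dots> = (\<tau>\<^sup>2) ^ m" using m by (simp add: power_mult[symmetric] mult.commute)
        finally show ?thesis by (simp add: power_mult_distrib mult.assoc)
      qed
      finally have "root m ((real m * \<tau>\<^sup>2) ^ m) < root m s" using m by (subst real_root_less_iff) auto
      then have "real m * \<tau>\<^sup>2 < root m s" using m by (subst (asm) real_root_power_cancel) auto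
      then have "real m * (pi * \<tau>\<^sup>2) < pi * root m s" by (simp add: mult.left_commute)
      then show ?thesis using \<tau> s m by (intro ennreal_lessI) auto
    qed
    finally show ?thesis .
  qed
  ultimately show ?thesis by (rule that)
qed

subsection \<open>Area of images with multiplicity\<close>

lemma
  fixes T :: "'a::euclidean_space \<Rightarrow> 'b::euclidean_space"
  assumes T: "T \<in> borel_measurable borel" and distr: "distr lborel borel T = lborel"
  shows measurable_lebesgue_of_distr_lborel: "T \<in> lebesgue \<rightarrow>\<^sub>M lebesgue"
    and distr_lebesgue_of_distr_lborel: "distr lebesgue lebesgue T = lebesgue"
proof -
  have Tl: "T \<in> lborel \<rightarrow>\<^sub>M lborel" using T by simp
  have eq: "distr lebesgue lborel T = lborel"
    using distr_completion[OF Tl] distr by (metis distr_cong sets_lborel)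
  \<comment> \<open>A measure-preserving Borel map pulls null sets back to null sets, so its
    measurability passes to the completions.\<close>
  show "T \<in> lebesgue \<rightarrow>\<^sub>M lebesgue"
    by (rule completion.measurable_completion2) (use Tl in \<open>auto simp: eq measurable_completion\<close>)
  have "completion (distr lebesgue lborel T) = distr lebesgue lebesgue T"
    by (subst completion.completion_distr_eq) (use Tl in \<open>auto simp: eq measurable_completion\<close>)
  then show "distr lebesgue lebesgue T = lebesgue" by (simp add: eq)
qed

text \<open>The change of variables theorem \<open>has_measure_differentiable_image\<close> takes
  the Jacobian as the determinant of a matrix and therefore lives on
  \<open>real ^ 'n\<close>.\<close>

definition vec_to_complex :: "real ^ 2 \<Rightarrow> complex" where
  "vec_to_complex v = Complex (v $ 1) (v $ 2)"

definition complex_to_vec :: "complex \<Rightarrow> real ^ 2" where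
  "complex_to_vec z = vector [Re z, Im z]"

lemma vec_to_complex_inverse [simp]: "complex_to_vec (vec_to_complex v) = v"
  by (simp add: vec_to_complex_def complex_to_vec_def vec_eq_iff forall_2)

lemma complex_to_vec_inverse [simp]: "vec_to_complex (complex_to_vec z) = z"
  by (simp add: vec_to_complex_def complex_to_vec_def)

lemma bounded_linear_vec_to_complex: "bounded_linear vec_to_complex"
  by (rule linear_conv_bounded_linear[THEN iffD1], rule linearI)
     (auto simp: vec_to_complex_def complex_eq_iff)

lemma bounded_linear_complex_to_vec: "bounded_linear complex_to_vec"
  by (rule linear_conv_bounded_linear[THEN iffD1], rule linearI)
     (auto simp: complex_to_vec_def vec_eq_iff forall_2)

lemma borel_measurable_vec_to_complex [measurable]: "vec_to_complex \<in> borel_measurable borel"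
  by (intro borel_measurable_continuous_onI linear_continuous_on bounded_linear_vec_to_complex)

lemma borel_measurable_complex_to_vec [measurable]: "complex_to_vec \<in> borel_measurable borel"
  by (intro borel_measurable_continuous_onI linear_continuous_on bounded_linear_complex_to_vec)

text \<open>\<open>lborel\<close> is determined by its values on boxes, and the preimage of a box is
  a box with the same side lengths.\<close>

lemma distr_lborel_vec_to_complex: "distr lborel borel vec_to_complex = lborel"
proof (rule lborel_eqI[symmetric])
  fix l u :: complex
  assume le: "\<And>b. b \<in> Basis \<Longrightarrow> l \<bullet> b \<le> u \<bullet> b"
  have le': "complex_to_vec l $ i \<le> complex_to_vec u $ i" for i
    using le[of 1] le[of \<i>] exhaust_2[of i] by (auto simp: complex_to_vec_def Basis_complex_def)
  have "vec_to_complex -` box l u = box (complex_to_vec l) (complex_to_vec u)"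
    by (auto simp: mem_box_cart forall_2 in_box_complex_iff vec_to_complex_def complex_to_vec_def)
  then have "emeasure (distr lborel borel vec_to_complex) (box l u)
           = emeasure lborel (box (complex_to_vec l) (complex_to_vec u))"
    by (subst emeasure_distr) auto
  also have "\<dots> = (\<Prod>b\<in>Basis. (complex_to_vec u - complex_to_vec l) \<bullet> b)"
    using le' by (intro emeasure_lborel_box) (auto simp: Basis_vec_def inner_axis)
  also have "(\<Prod>b\<in>Basis. (complex_to_vec u - complex_to_vec l) \<bullet> b) = (\<Prod>i\<in>UNIV. (complex_to_vec u - complex_to_vec l) $ i)"
    unfolding Basis_vec_def by (subst prod.reindex_bij_betw[symmetric, of "\<lambda>i. axis i 1" UNIV])
      (auto simp: bij_betw_def inj_on_def axis_eq_axis inner_axis)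
  also have "\<dots> = (\<Prod>b\<in>Basis. (u - l) \<bullet> b)"
    by (simp add: UNIV_2 Basis_complex_def complex_to_vec_def)
  finally show "emeasure (distr lborel borel vec_to_complex) (box l u) = ennreal (\<Prod>b\<in>Basis. (u - l) \<bullet> b)" .
qed simp

lemma distr_lborel_complex_to_vec: "distr lborel borel complex_to_vec = lborel"
proof -
  have "distr lborel borel complex_to_vec = distr (distr lborel borel vec_to_complex) borel complex_to_vec"
    by (simp add: distr_lborel_vec_to_complex)
  also have "\<dots> = distr lborel borel (complex_to_vec \<circ> vec_to_complex)"
    by (subst distr_distr) auto
  also have "\<dots> = distr lborel lborel (\<lambda>x. x)"
    by (intro distr_cong) auto
  finally show ?thesis by (simp add: distr_id)
qed

lemmas measurable_vec_to_complex_lebesgue =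
  measurable_lebesgue_of_distr_lborel[OF borel_measurable_vec_to_complex distr_lborel_vec_to_complex]
lemmas distr_lebesgue_vec_to_complex =
  distr_lebesgue_of_distr_lborel[OF borel_measurable_vec_to_complex distr_lborel_vec_to_complex]
lemmas measurable_complex_to_vec_lebesgue =
  measurable_lebesgue_of_distr_lborel[OF borel_measurable_complex_to_vec distr_lborel_complex_to_vec]
lemmas distr_lebesgue_complex_to_vec =
  distr_lebesgue_of_distr_lborel[OF borel_measurable_complex_to_vec distr_lborel_complex_to_vec]

text \<open>Multiplication by \<open>a\<close> has the rows \<open>(Re a, - Im a)\<close> and
  \<open>(Im a, Re a)\<close>; this is why the Jacobian of a holomorphic map is the squared modulus
  of its derivative.\<close>

lemma det_complex_mult:
  "det (matrix (\<lambda>v. complex_to_vec (a * vec_to_complex v))) = (cmod a)\<^sup>2"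
  unfolding cmod_power2
  by (simp add: det_2 matrix_def complex_to_vec_def vec_to_complex_def axis_def power2_eq_square)

text \<open>Change of variables for the conjugated map \<open>g\<close> on \<open>real ^ 2\<close>.
  Since \<open>K\<close> is bounded and \<open>f'\<close> is continuous, the Jacobian is bounded on
  \<open>K\<close> and hence integrable there.\<close>

lemma area_injective_holomorphic_image:
  fixes f f' :: "complex \<Rightarrow> complex"
  assumes K: "K \<in> sets lebesgue" "bounded K"
    and f: "\<And>z. z \<in> K \<Longrightarrow> (f has_field_derivative f' z) (at z)" and inj: "inj_on f K"
    and cont: "continuous_on UNIV f'"
  shows "f ` K \<in> sets lebesgue"
    and "emeasure lebesgue (f ` K) = (\<integral>\<^sup>+z\<in>K. ennreal ((cmod (f' z))\<^sup>2) \<partial>lebesgue)"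
proof -
  obtain B where B: "\<And>z. z \<in> K \<Longrightarrow> cmod (f' z) \<le> B"
  proof -
    have "compact (closure K)" using K(2) by simp
    then have "bounded (f' ` closure K)"
      by (intro compact_imp_bounded compact_continuous_image continuous_on_subset[OF cont]) auto
    then show ?thesis using that closure_subset[of K] by (auto simp: bounded_iff)
  qed
  have f': "f' \<in> borel_measurable borel" by (rule borel_measurable_continuous_onI[OF cont])
  define S where "S = vec_to_complex -` K"
  define h where "h = (\<lambda>x. (cmod (f' (vec_to_complex x)))\<^sup>2)"
  define g where "g = complex_to_vec \<circ> f \<circ> vec_to_complex"
  have S_img: "S = complex_to_vec ` K"
    by (auto simp: S_def image_iff) (metis vec_to_complex_inverse)
  have S: "S \<in> sets lebesgue"
    using measurable_sets[OF measurable_vec_to_complex_lebesgue K(1)] by (simp add: S_def)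
  have "bounded S"
    unfolding S_img by (rule bounded_linear_image[OF K(2) bounded_linear_complex_to_vec])
  with S have Slm: "S \<in> lmeasurable" by (rule bounded_set_imp_lmeasurable[rotated])
  have der: "(g has_derivative (\<lambda>v. complex_to_vec (f' (vec_to_complex x) * vec_to_complex v))) (at x within S)"
    if "x \<in> S" for x
  proof -
    have "(f has_derivative (\<lambda>v. f' (vec_to_complex x) * v)) (at (vec_to_complex x))"
      using f that by (auto simp: S_def has_field_derivative_def)
    moreover have "(vec_to_complex has_derivative vec_to_complex) (at x)"
      by (rule bounded_linear_imp_has_derivative[OF bounded_linear_vec_to_complex])
    ultimately have "((\<lambda>x. f (vec_to_complex x)) has_derivative (\<lambda>v. f' (vec_to_complex x) * vec_to_complex v)) (at x)"
      using diff_chain_at[of vec_to_complex vec_to_complex x f] by (simp add: o_def)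
    from bounded_linear.has_derivative[OF bounded_linear_complex_to_vec this]
    show ?thesis by (simp add: g_def o_def has_derivative_at_withinI)
  qed
  have injg: "inj_on g S"
    using inj unfolding g_def S_def inj_on_def
    by (auto) (metis complex_to_vec_inverse vec_to_complex_inverse)
  have hm: "h \<in> borel_measurable borel" unfolding h_def using f' by measurable
  have int: "set_integrable lebesgue S h"
    unfolding set_integrable_def
  proof (rule Bochner_Integration.integrable_bound)
    show "integrable lebesgue (\<lambda>x. indicator S x *\<^sub>R B\<^sup>2)"
      using Slm by (intro integrable_scaleR_left integrable_real_indicator) (auto simp: fmeasurable_def)
    show "(\<lambda>x. indicator S x *\<^sub>R h x) \<in> borel_measurable lebesgue"
      using S hm by (intro borel_measurable_scaleR borel_measurable_indicator measurable_completion) auto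
    show "AE x in lebesgue. norm (indicat_real S x *\<^sub>R h x) \<le> norm (indicat_real S x *\<^sub>R B\<^sup>2)"
      using B by (intro AE_I2) (auto simp: indicator_def h_def S_def intro: power_mono)
  qed
  have "(h has_integral (LINT x:S|lebesgue. h x)) S"
    by (rule has_integral_set_lebesgue[OF int])
  then have gS: "g ` S \<in> lmeasurable" "measure lebesgue (g ` S) = (LINT x:S|lebesgue. h x)"
    using has_measure_differentiable_image[OF S der injg, of "LINT x:S|lebesgue. h x"]
    by (simp_all add: det_complex_mult h_def)
  \<comment> \<open>Written as a preimage, so that measurability and measure of \<open>f\<close>
    K\<open>can be read off from those of\<close>g \<open>S\<close>.\<close>
  have fK: "f ` K = complex_to_vec -` (g ` S)"
  proof -
    have "g ` S = complex_to_vec ` f ` K" by (simp add: g_def S_img image_image)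
    then show ?thesis by (auto simp: image_iff) (metis complex_to_vec_inverse)
  qed
  have gSs: "g ` S \<in> sets lebesgue" using gS by auto
  show "f ` K \<in> sets lebesgue"
    unfolding fK using measurable_sets[OF measurable_complex_to_vec_lebesgue gSs] by simp
  have "emeasure lebesgue (f ` K) = emeasure (distr lebesgue lebesgue complex_to_vec) (g ` S)"
    unfolding fK by (subst emeasure_distr[OF measurable_complex_to_vec_lebesgue gSs]) simp
  also have "\<dots> = ennreal (LINT x:S|lebesgue. h x)"
    using gS unfolding distr_lebesgue_complex_to_vec by (simp add: emeasure_eq_measure2)
  also have "\<dots> = (\<integral>\<^sup>+x. ennreal (indicator S x *\<^sub>R h x) \<partial>lebesgue)"
    using int unfolding set_integrable_def set_lebesgue_integral_def
    by (intro nn_integral_eq_integral[symmetric]) (auto simp: h_def)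
  also have "\<dots> = (\<integral>\<^sup>+x. ennreal ((cmod (f' (vec_to_complex x)))\<^sup>2) * indicator K (vec_to_complex x) \<partial>lebesgue)"
    by (intro nn_integral_cong) (auto simp: h_def S_def indicator_def)
  also have "\<dots> = (\<integral>\<^sup>+z\<in>K. ennreal ((cmod (f' z))\<^sup>2) \<partial>distr lebesgue lebesgue vec_to_complex)"
  proof (rule nn_integral_distr[OF measurable_vec_to_complex_lebesgue, symmetric])
    have "(\<lambda>z. ennreal ((cmod (f' z))\<^sup>2)) \<in> borel_measurable lebesgue"
      using f' by (intro measurable_completion) simp
    then show "(\<lambda>z. ennreal ((cmod (f' z))\<^sup>2) * indicator K z) \<in> borel_measurable (distr lebesgue lebesgue vec_to_complex)"
      unfolding distr_lebesgue_vec_to_complex using K(1) by measurable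
  qed
  finally show "emeasure lebesgue (f ` K) = (\<integral>\<^sup>+z\<in>K. ennreal ((cmod (f' z))\<^sup>2) \<partial>lebesgue)"
    by (simp add: distr_lebesgue_vec_to_complex)
qed

section \<open>Counting preimages through a countable partition into pieces of injectivity\<close>

lemma valency_noncritical:
  assumes "poly (pderiv p) w \<noteq> 0"
  shows "valency p w = 1"
proof -
  let ?q = "p - [:poly p w:]"
  have q': "pderiv ?q = pderiv p" by (simp add: pderiv_diff pderiv_pCons)
  have "pderiv p \<noteq> 0" using assms by auto
  then have "?q \<noteq> 0" using q' by force
  moreover have "poly ?q w = 0" by simp
  \<comment> \<open>Differentiation lowers the order of a root by one.\<close>
  ultimately have "order w ?q = Suc (order w (pderiv ?q))" by (rule order_pderiv)
  also have "order w (pderiv ?q) = 0" unfolding q' using assms by (rule order_0I)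
  finally show ?thesis by (simp add: valency_def)
qed

text \<open>A nonzero derivative gives a disc of injectivity around each noncritical point; Lindelof
  leaves countably many such sets, and \<open>disjointed\<close> makes them disjoint without losing
  boundedness or injectivity.\<close>

lemma locally_injective_cover:
  assumes p: "pderiv p \<noteq> (0 :: complex poly)"
  obtains B :: "nat \<Rightarrow> complex set"
  where "disjoint_family B" "\<And>i. B i \<in> sets borel" "\<And>i. bounded (B i)" "\<And>i. inj_on (poly p) (B i)"
    and "(\<Union>i. B i) = - critical_points p"
proof -
  let ?F = "{b. open b \<and> bounded b \<and> inj_on (poly p) b \<and> b \<subseteq> - critical_points p}"
  have op: "open (- critical_points p)"
    unfolding critical_points_def using poly_roots_finite[OF p] by (intro open_Compl finite_imp_closed)
  have cover: "\<exists>b\<in>?F. z \<in> b" if z: "z \<notin> critical_points p" for z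
  proof -
    have "deriv (poly p) z \<noteq> 0"
      using z DERIV_imp_deriv[OF poly_DERIV, of p z] by (simp add: critical_points_def)
    moreover have "poly p holomorphic_on - critical_points p"
      unfolding holomorphic_on_def field_differentiable_def using poly_DERIV[of p] has_field_derivative_at_within by blast
    ultimately obtain r where "r > 0" "ball z r \<subseteq> - critical_points p" "inj_on (poly p) (ball z r)"
      using has_complex_derivative_locally_injective[of "poly p" "- critical_points p" z] op z by blast
    then show ?thesis by (intro bexI[of _ "ball z r"]) auto
  qed
  obtain F where F: "F \<subseteq> ?F" "countable F" "\<Union>F = \<Union>?F"
    by (rule Lindelof[of ?F]) auto
  have "\<Union>?F = - critical_points p" using cover by blast
  with F have UF: "\<Union>F = - critical_points p" by simp
  \<comment> \<open>Cofinitely many points have to be covered, so \<open>F\<close> is nonempty and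
    \<open>from_nat_into\<close> enumerates it.\<close>
  have "infinite (- critical_points p)"
    unfolding critical_points_def using poly_roots_finite[OF p] infinite_UNIV_char_0
    by (metis Compl_eq_Diff_UNIV finite_Diff2)
  then have "F \<noteq> {}" using UF by auto
  define b where "b = from_nat_into F"
  have b: "b i \<in> ?F" for i using F(1) from_nat_into[OF \<open>F \<noteq> {}\<close>] by (auto simp: b_def)
  have ran: "range b = F" unfolding b_def by (rule range_from_nat_into[OF \<open>F \<noteq> {}\<close> F(2)])
  have sub: "disjointed b i \<subseteq> b i" for i by (rule disjointed_subset)
  show ?thesis
  proof (rule that[of "disjointed b"])
    show "disjoint_family (disjointed b)" by (rule disjoint_family_disjointed)
    show "disjointed b i \<in> sets borel" for i
    proof -
      have "range b \<subseteq> sets borel" using b borel_open by blast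
      then show ?thesis using sets.range_disjointed_sets[of b borel] by blast
    qed
    show "bounded (disjointed b i)" "inj_on (poly p) (disjointed b i)" for i
      using b[of i] sub[of i] by (auto intro: bounded_subset inj_on_subset)
    show "(\<Union>i. disjointed b i) = - critical_points p"
      using UF ran by (simp add: UN_disjointed_eq)
  qed
qed

text \<open>Every preimage of a noncritical value has valency 1 and lies in exactly one piece, and
  by injectivity each piece holds at most one preimage; the multiplicity thus counts the pieces
  whose image contains \<open>z\<close>.\<close>

lemma preimage_mult_eq_suminf_indicator:
  assumes p: "pderiv p \<noteq> 0" and z: "z \<notin> poly p ` critical_points p"
    and B: "disjoint_family B" "\<And>i. inj_on (poly p) (B i)" "(\<Union>i. B i) = - critical_points p"
  shows "of_nat (preimage_mult z p K) = (\<Sum>i. indicator (poly p ` (K \<inter> B i)) z :: ennreal)"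
proof -
  define X where "X = {w \<in> K. poly p w = z}"
  have nc: "w \<in> - critical_points p" if "w \<in> X" for w
    using that z by (auto simp: X_def)
  have "finite X"
  proof -
    have "p - [:z:] \<noteq> 0" using p by (auto simp: pderiv_pCons)
    then have "finite {w. poly (p - [:z:]) w = 0}" by (rule poly_roots_finite)
    then show ?thesis by (rule rev_finite_subset) (auto simp: X_def)
  qed
  have ind: "indicator (poly p ` (K \<inter> B i)) z = (\<Sum>w\<in>X. indicator (B i) w :: ennreal)" for i
  proof (cases "z \<in> poly p ` (K \<inter> B i)")
    case True
    then obtain w where w: "w \<in> X" "w \<in> B i" by (auto simp: X_def)
    have uniq: "v = w" if "v \<in> X" "v \<in> B i" for v
      using that w B(2)[of i] by (auto simp: X_def inj_on_def)
    have "(\<Sum>v\<in>X. indicator (B i) v :: ennreal) = (\<Sum>v\<in>X. if v = w then 1 else 0)"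
    proof (rule sum.cong[OF refl])
      fix v assume "v \<in> X"
      with uniq w have "v \<in> B i \<longleftrightarrow> v = w" by blast
      then show "(indicator (B i) v :: ennreal) = (if v = w then 1 else 0)" by (simp add: indicator_def)
    qed
    then show ?thesis using True w \<open>finite X\<close> by simp
  next
    case False
    then have "(\<Sum>w\<in>X. indicator (B i) w :: ennreal) = 0"
      by (intro sum.neutral) (auto simp: X_def indicator_def)
    then show ?thesis using False by simp
  qed
  have "preimage_mult z p K = (\<Sum>w\<in>X. 1)"
    unfolding preimage_mult_def X_def[symmetric]
    using nc by (intro sum.cong) (auto simp: critical_points_def valency_noncritical)
  then have "of_nat (preimage_mult z p K) = (\<Sum>w\<in>X. 1 :: ennreal)" by simp
  also have "\<dots> = (\<Sum>w\<in>X. \<Sum>i. indicator (B i) w)"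
    using nc B(3) by (intro sum.cong) (auto simp: suminf_indicator[OF B(1)])
  also have "\<dots> = (\<Sum>i. \<Sum>w\<in>X. indicator (B i) w)"
    by (rule suminf_sum[symmetric]) auto
  finally show ?thesis by (simp add: ind)
qed

text \<open>Summing the area formula over the pieces \<open>K \<inter> B i\<close>. The critical
  points and critical values are finitely many and do not affect either integral.\<close>

theorem nn_integral_preimage_mult:
  assumes K: "K \<in> sets lebesgue"
  shows "(\<integral>\<^sup>+ z. of_nat (preimage_mult z p K) \<partial>lebesgue)
           = (\<integral>\<^sup>+ z\<in>K. ennreal ((cmod (poly (pderiv p) z))\<^sup>2) \<partial>lebesgue)"
proof (cases "pderiv p = 0")
  case True
  then obtain c where c: "p = [:c:]" by (auto simp: pderiv_eq_0_iff elim: degree_eq_zeroE)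
  \<comment> \<open>For constant \<open>p\<close> the index set of \<open>preimage_mult\<close> is
    empty at every \<open>z\<close> except the single value \<open>c\<close>.\<close>
  have "AE z in lebesgue. z \<noteq> c"
    by (rule AE_I'[of "{c}"]) (auto simp: null_sets_completionI)
  then have "AE z in lebesgue. (of_nat (preimage_mult z p K) :: ennreal) = 0"
    by eventually_elim (auto simp: preimage_mult_def c)
  then have "(\<integral>\<^sup>+ z. of_nat (preimage_mult z p K) \<partial>lebesgue) = (\<integral>\<^sup>+ z. 0 \<partial>(lebesgue :: complex measure))"
    by (rule nn_integral_cong_AE)
  then show ?thesis using True by simp
next
  case False
  obtain B :: "nat \<Rightarrow> complex set" where B: "disjoint_family B" "\<And>i. B i \<in> sets borel" "\<And>i. bounded (B i)"
    "\<And>i. inj_on (poly p) (B i)" "(\<Union>i. B i) = - critical_points p"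
    using locally_injective_cover[OF False] by blast
  have fin: "finite (critical_points p)"
    unfolding critical_points_def by (rule poly_roots_finite[OF False])
  have ae: "AE z in lebesgue. z \<notin> X" if "finite X" for X :: "complex set"
    by (rule AE_I'[of X]) (use finite_imp_null_set_lborel[OF that] in \<open>auto simp: null_sets_completionI\<close>)
  have KB: "K \<inter> B i \<in> sets lebesgue" for i using K B(2)[of i] by (intro sets.Int) auto
  have cont: "continuous_on UNIV (poly (pderiv p))" by (intro continuous_intros)
  have img: "poly p ` (K \<inter> B i) \<in> sets lebesgue"
    "emeasure lebesgue (poly p ` (K \<inter> B i)) = (\<integral>\<^sup>+ z\<in>K \<inter> B i. ennreal ((cmod (poly (pderiv p) z))\<^sup>2) \<partial>lebesgue)" for i
  proof -
    note area = area_injective_holomorphic_image[where f = "poly p", OF KB _ poly_DERIV _ cont]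
    show "poly p ` (K \<inter> B i) \<in> sets lebesgue"
      by (rule area) (use B(3,4)[of i] in \<open>auto intro: bounded_subset inj_on_subset\<close>)
    show "emeasure lebesgue (poly p ` (K \<inter> B i)) = (\<integral>\<^sup>+ z\<in>K \<inter> B i. ennreal ((cmod (poly (pderiv p) z))\<^sup>2) \<partial>lebesgue)"
      by (rule area) (use B(3,4)[of i] in \<open>auto intro: bounded_subset inj_on_subset\<close>)
  qed
  have meas: "(\<lambda>z. ennreal ((cmod (poly (pderiv p) z))\<^sup>2)) \<in> borel_measurable lebesgue"
    by (intro measurable_completion) (use borel_measurable_continuous_onI[OF cont] in simp)
  have "AE z in lebesgue. of_nat (preimage_mult z p K) = (\<Sum>i. indicator (poly p ` (K \<inter> B i)) z :: ennreal)"
    using ae[OF finite_imageI[OF fin, of "poly p"]]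
    by eventually_elim (rule preimage_mult_eq_suminf_indicator[OF False _ B(1,4,5)])
  then have "(\<integral>\<^sup>+ z. of_nat (preimage_mult z p K) \<partial>lebesgue)
      = (\<integral>\<^sup>+ z. (\<Sum>i. indicator (poly p ` (K \<inter> B i)) z) \<partial>lebesgue)"
    by (rule nn_integral_cong_AE)
  also have "\<dots> = (\<Sum>i. emeasure lebesgue (poly p ` (K \<inter> B i)))"
    using img(1) by (subst nn_integral_suminf) auto
  also have "\<dots> = (\<Sum>i. \<integral>\<^sup>+ z. ennreal ((cmod (poly (pderiv p) z))\<^sup>2) * indicator (K \<inter> B i) z \<partial>lebesgue)"
    by (simp add: img(2))
  also have "\<dots> = (\<integral>\<^sup>+ z. (\<Sum>i. ennreal ((cmod (poly (pderiv p) z))\<^sup>2) * indicator (K \<inter> B i) z) \<partial>lebesgue)"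
    using meas KB by (intro nn_integral_suminf[symmetric]) auto
  also have "\<dots> = (\<integral>\<^sup>+ z\<in>K. ennreal ((cmod (poly (pderiv p) z))\<^sup>2) \<partial>lebesgue)"
  proof (rule nn_integral_cong_AE)
    have dj: "disjoint_family (\<lambda>i. K \<inter> B i)" using B(1) by (auto simp: disjoint_family_on_def)
    have un: "(\<Union>i. K \<inter> B i) = K - critical_points p" using B(5) by auto
    show "AE z in lebesgue. (\<Sum>i. ennreal ((cmod (poly (pderiv p) z))\<^sup>2) * indicator (K \<inter> B i) z)
        = ennreal ((cmod (poly (pderiv p) z))\<^sup>2) * indicator K z"
      using ae[OF fin]
    proof eventually_elim
      case (elim z)
      then show ?case
        unfolding ennreal_suminf_cmult suminf_indicator[OF dj] un by (simp add: indicator_def)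
    qed
  qed
  finally show ?thesis .
qed

subsection \<open>The integral of the squared modulus of a monic polynomial\<close>

lemma AE_lborel_ex_in_interval:
  assumes "AE s in lborel. P s" "u < (v::real)"
  obtains s where "u < s" "s < v" "P s"
proof (rule ccontr)
  assume "\<not> thesis"
  with that have "{u<..<v} \<subseteq> {s \<in> space lborel. \<not> P s}" by auto
  moreover obtain N where "{s \<in> space lborel. \<not> P s} \<subseteq> N" "emeasure lborel N = 0" "N \<in> sets lborel"
    using AE_E[OF assms(1)] by metis
  ultimately have "emeasure lborel {u<..<v} \<le> 0" by (metis emeasure_mono order_trans)
  then show False using assms(2) by simp
qed

text \<open>The difference \<open>f - g\<close> has integral zero; finiteness of the integral of
  \<open>g\<close> justifies the subtraction and makes \<open>g\<close> finite almost
  everywhere.\<close>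

lemma AE_eq_of_le_of_nn_integral_eq:
  assumes [measurable]: "f \<in> borel_measurable M" "g \<in> borel_measurable M"
    and le: "\<And>x. x \<in> space M \<Longrightarrow> g x \<le> f x" and eq: "(\<integral>\<^sup>+x. f x \<partial>M) = (\<integral>\<^sup>+x. g x \<partial>M)"
    and fin: "(\<integral>\<^sup>+x. g x \<partial>M) \<noteq> \<infinity>"
  shows "AE x in M. f x = g x"
proof -
  have "(\<integral>\<^sup>+x. f x - g x \<partial>M) = 0"
    using fin le by (subst nn_integral_diff) (auto simp: eq)
  then have "AE x in M. f x - g x = 0"
    by (subst (asm) nn_integral_0_iff_AE) auto
  moreover have "AE x in M. g x \<noteq> \<infinity>"
    by (rule nn_integral_noteq_infinite) (use fin in auto)
  ultimately show ?thesis using AE_space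
    by eventually_elim (metis antisym ennreal_minus_eq_0 le)
qed

text \<open>The layer cake formula for \<open>x ^ m\<close> on \<open>{0..a}\<close>: the superlevel
  set at \<open>s\<close> is \<open>{root m s<..a}\<close>, of length \<open>a - root m s\<close>,
  truncated at zero by \<open>ennreal\<close> once \<open>s\<close> exceeds
  \<open>a ^ m\<close>.\<close>

lemma nn_integral_minus_root:
  assumes m: "0 < m" and a: "0 \<le> a" and c: "0 \<le> c"
  shows "(\<integral>\<^sup>+s\<in>{0<..}. ennreal (c * a - c * root m s) \<partial>lborel) = ennreal c * ennreal (a ^ Suc m / real (Suc m))"
proof -
  have "(\<integral>\<^sup>+x\<in>{0..a}. ennreal (x ^ m) \<partial>lborel) = (\<integral>\<^sup>+s\<in>{0<..}. emeasure lborel {x\<in>{0..a}. s < x ^ m} \<partial>lborel)"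
    by (rule nn_integral_layer_cake) (auto simp: lborel.sigma_finite_measure_axioms)
  also have "\<dots> = (\<integral>\<^sup>+s\<in>{0<..}. ennreal (a - root m s) \<partial>lborel)"
  proof (rule nn_integral_cong)
    fix s :: real
    have "emeasure lborel {x\<in>{0..a}. s < x ^ m} = ennreal (a - root m s)" if "0 < s"
    proof -
      have "s < x ^ m \<longleftrightarrow> root m s < x" if "0 \<le> x" for x
        using m that \<open>0 < s\<close> by (metis less_eq_real_def real_root_less_iff real_root_power_cancel)
      then have "{x\<in>{0..a}. s < x ^ m} = {root m s<..a}"
        using real_root_gt_zero[OF m that] by auto
      moreover have "emeasure lborel {root m s<..a} = ennreal (a - root m s)"
        by (cases "root m s \<le> a") (auto simp: ennreal_neg)
      ultimately show ?thesis by simp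
    qed
    then show "emeasure lborel {x\<in>{0..a}. s < x ^ m} * indicator {0<..} s = ennreal (a - root m s) * indicator {0<..} s"
      by (auto simp: indicator_def)
  qed
  finally have *: "(\<integral>\<^sup>+s\<in>{0<..}. ennreal (a - root m s) \<partial>lborel) = (\<integral>\<^sup>+x\<in>{0..a}. ennreal (x ^ m) \<partial>lborel)" ..
  have "(\<integral>\<^sup>+x\<in>{0..a}. ennreal (x ^ m) \<partial>lborel) = ennreal (a ^ Suc m / real (Suc m) - 0 ^ Suc m / real (Suc m))"
  proof (rule nn_integral_FTC_Icc)
    show "DERIV (\<lambda>x. x ^ Suc m / real (Suc m)) x :> x ^ m" for x
      by (rule derivative_eq_intros refl | simp)+
  qed (use a in auto)
  moreover have "(\<integral>\<^sup>+s\<in>{0<..}. ennreal (c * a - c * root m s) \<partial>lborel)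
    = (\<integral>\<^sup>+s. ennreal c * (ennreal (a - root m s) * indicator {0<..} s) \<partial>lborel)"
    by (intro nn_integral_cong)
      (simp add: right_diff_distrib[symmetric] ennreal_mult'[OF c] mult.assoc)
  moreover have "\<dots> = ennreal c * (\<integral>\<^sup>+s\<in>{0<..}. ennreal (a - root m s) \<partial>lborel)"
    by (intro nn_integral_cmult) (auto intro!: borel_measurable_continuous_onI continuous_intros m)
  ultimately show ?thesis using * by simp
qed

section \<open>Integrals of the squared modulus: lower bound, infinite area, discs and
  equality\<close>

context
  fixes r :: "nat \<Rightarrow> complex" and m :: nat and g :: "complex \<Rightarrow> real"
  assumes m: "0 < m"
  defines "g \<equiv> \<lambda>z. (cmod (\<Prod>i<m. z - r i))\<^sup>2"
begin

lemma measurable_sq_modulus: "g \<in> borel_measurable lebesgue"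
proof (rule measurable_completion)
  have "continuous_on UNIV g" unfolding g_def by (intro continuous_intros)
  then show "g \<in> borel_measurable lborel" using borel_measurable_continuous_onI by simp
qed

lemma sets_sublevel: "{z. g z \<le> s} \<in> sets lebesgue"
  using measurable_sets[OF measurable_sq_modulus, of "{..s}"] by (simp add: vimage_def)

lemma sets_superlevel: "K \<in> sets lebesgue \<Longrightarrow> {z\<in>K. s < g z} \<in> sets lebesgue"
proof -
  assume "K \<in> sets lebesgue"
  moreover have "{z\<in>K. s < g z} = K - {z. g z \<le> s}" by auto
  ultimately show ?thesis using sets_sublevel by auto
qed

lemma emeasure_split_level:
  assumes "K \<in> sets lebesgue"
  shows "emeasure lebesgue K = emeasure lebesgue (K \<inter> {z. g z \<le> s}) + emeasure lebesgue {z\<in>K. s < g z}"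
proof -
  have "emeasure lebesgue (K \<inter> {z. g z \<le> s}) + emeasure lebesgue {z\<in>K. s < g z}
      = emeasure lebesgue (K \<inter> {z. g z \<le> s} \<union> {z\<in>K. s < g z})"
    by (rule plus_emeasure) (use assms sets_sublevel[of s] sets_superlevel[of K s] in auto)
  also have "K \<inter> {z. g z \<le> s} \<union> {z\<in>K. s < g z} = K" by auto
  finally show ?thesis by (rule sym)
qed

lemma emeasure_sublevel_le: "0 \<le> s \<Longrightarrow> emeasure lebesgue {z. g z \<le> s} \<le> ennreal (pi * root m s)"
  unfolding g_def by (rule lemniscate_area_root[OF m])

text \<open>By Polya's inequality at most \<open>pi * root m s\<close> of the area of
  \<open>K\<close> can lie in the sublevel set.\<close>

lemma emeasure_superlevel_ge:
  assumes K: "K \<in> sets lebesgue" "emeasure lebesgue K = ennreal (pi * a)" and s: "0 \<le> s"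
  shows "ennreal (pi * a - pi * root m s) \<le> emeasure lebesgue {z\<in>K. s < g z}"
proof -
  have "emeasure lebesgue (K \<inter> {z. g z \<le> s}) \<le> ennreal (pi * root m s)"
    by (rule order_trans[OF emeasure_mono emeasure_sublevel_le[OF s]]) (auto simp: sets_sublevel)
  then have "ennreal (pi * a) \<le> ennreal (pi * root m s) + emeasure lebesgue {z\<in>K. s < g z}"
    unfolding K(2)[symmetric] emeasure_split_level[OF K(1), of s] by (rule add_right_mono)
  then have "ennreal (pi * a) - ennreal (pi * root m s) \<le> emeasure lebesgue {z\<in>K. s < g z}"
    by (simp add: ennreal_minus_le_iff)
  then show ?thesis using s m by (simp add: ennreal_minus)
qed

lemma layer_cake_sq_modulus:
  "K \<in> sets lebesgue \<Longrightarrow>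
    (\<integral>\<^sup>+z\<in>K. ennreal (g z) \<partial>lebesgue) = (\<integral>\<^sup>+s\<in>{0<..}. emeasure lebesgue {z\<in>K. s < g z} \<partial>lborel)"
  by (rule nn_integral_layer_cake[OF sigma_finite_lebesgue measurable_sq_modulus])

text \<open>The bound on superlevel sets, integrated over \<open>s\<close> by the layer cake
  formula; \<open>nn_integral_minus_root\<close> supplies the value.\<close>

lemma nn_integral_sq_modulus_ge:
  assumes K: "K \<in> sets lebesgue" "emeasure lebesgue K = ennreal (pi * a)" and a: "0 \<le> a"
  shows "ennreal pi * ennreal (a ^ Suc m / real (Suc m)) \<le> (\<integral>\<^sup>+z\<in>K. ennreal (g z) \<partial>lebesgue)"
  unfolding layer_cake_sq_modulus[OF K(1)] nn_integral_minus_root[OF m a pi_ge_zero, symmetric]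
  by (intro nn_integral_mono) (auto simp: indicator_def intro: emeasure_superlevel_ge[OF K])

text \<open>Sublevel sets have finite area, so every superlevel part of \<open>K\<close> is left
  with infinite area.\<close>

lemma nn_integral_sq_modulus_infinite:
  assumes K: "K \<in> sets lebesgue" "emeasure lebesgue K = \<infinity>"
  shows "(\<integral>\<^sup>+z\<in>K. ennreal (g z) \<partial>lebesgue) = \<infinity>"
proof -
  have top: "emeasure lebesgue {z\<in>K. s < g z} = \<infinity>" if "0 < s" for s
  proof -
    have "emeasure lebesgue (K \<inter> {z. g z \<le> s}) \<le> ennreal (pi * root m s)"
      by (rule order_trans[OF emeasure_mono emeasure_sublevel_le]) (use that in \<open>auto simp: sets_sublevel\<close>)
    then have "emeasure lebesgue (K \<inter> {z. g z \<le> s}) \<noteq> \<infinity>" by (auto simp: top_unique)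
    then show ?thesis
      using emeasure_split_level[OF K(1), of s] K(2) by (metis ennreal_add_eq_top infinity_ennreal_def)
  qed
  have "(\<integral>\<^sup>+z\<in>K. ennreal (g z) \<partial>lebesgue) = (\<integral>\<^sup>+s. \<infinity> * indicator {0::real<..} s \<partial>lborel)"
    unfolding layer_cake_sq_modulus[OF K(1)] by (intro nn_integral_cong) (auto simp: indicator_def top)
  also have "\<dots> = \<infinity> * emeasure lborel {0::real<..}"
    by (rule nn_integral_cmult_indicator) simp
  also have "\<dots> = \<infinity>" 
  proof -
    have "emeasure lborel {0<..<1::real} \<le> emeasure lborel {0::real<..}" by (intro emeasure_mono) auto
    then show ?thesis by (auto simp: ennreal_top_mult)
  qed
  finally show ?thesis .
qed

lemma sq_modulus_single_root:
  assumes "\<And>i. i < m \<Longrightarrow> r i = c"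
  shows "g z = ((dist c z)\<^sup>2) ^ m"
  using assms by (simp add: g_def norm_power power_mult[symmetric] mult.commute dist_norm norm_minus_commute)

lemma sublevel_single_root:
  assumes "\<And>i. i < m \<Longrightarrow> r i = c"
  shows "{z. g z \<le> s} = cball c (sqrt (root m s))"
proof -
  have "((dist c z)\<^sup>2) ^ m \<le> s \<longleftrightarrow> dist c z \<le> sqrt (root m s)" for z
  proof -
    have "((dist c z)\<^sup>2) ^ m \<le> s \<longleftrightarrow> (dist c z)\<^sup>2 \<le> root m s"
      using m real_root_le_iff[OF m, of "((dist c z)\<^sup>2) ^ m" s] by (simp add: real_root_power_cancel)
    also have "\<dots> \<longleftrightarrow> dist c z \<le> sqrt (root m s)"
      using real_sqrt_le_iff[of "(dist c z)\<^sup>2" "root m s"] by simp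
    finally show ?thesis .
  qed
  then show ?thesis using sq_modulus_single_root[OF assms] by auto
qed

text \<open>With a single root the sublevel sets are discs concentric with the given one, and the
  superlevel bound is an equality at each \<open>s > 0\<close>; for \<open>t \<ge> R\<close> both
  sides vanish through truncation.\<close>

lemma nn_integral_sq_modulus_disc:
  assumes root: "\<And>i. i < m \<Longrightarrow> r i = c" and R: "0 \<le> R"
  shows "(\<integral>\<^sup>+z\<in>ball c R. ennreal (g z) \<partial>lebesgue) = ennreal pi * ennreal ((R\<^sup>2) ^ Suc m / real (Suc m))"
proof -
  have "emeasure lebesgue {z\<in>ball c R. s < g z} = ennreal (pi * R\<^sup>2 - pi * root m s)" if s: "0 < s" for s
  proof -
    define t where "t = sqrt (root m s)"
    have t: "0 \<le> t" "t\<^sup>2 = root m s" using s m by (simp_all add: t_def)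
    have sub: "{z. g z \<le> s} = cball c t" using sublevel_single_root[OF root, of s] by (simp add: t_def)
    show ?thesis
    proof (cases "t < R")
      case True
      have "{z\<in>ball c R. s < g z} = ball c R - cball c t" using sub by (auto simp: set_eq_iff not_le[symmetric])
      moreover have "emeasure lebesgue (ball c R - cball c t) = emeasure lebesgue (ball c R) - emeasure lebesgue (cball c t)"
      proof (rule emeasure_Diff)
        show "emeasure lebesgue (cball c t) \<noteq> \<infinity>"
          unfolding emeasure_lebesgue_cball_complex[OF t(1)] by simp
        show "cball c t \<subseteq> ball c R" using True by auto
      qed auto
      ultimately have "emeasure lebesgue {z\<in>ball c R. s < g z} = ennreal (pi * R\<^sup>2) - ennreal (pi * t\<^sup>2)"
        by (simp only: emeasure_lebesgue_ball_complex[OF R] emeasure_lebesgue_cball_complex[OF t(1)])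
      then show ?thesis
        unfolding t(2)[symmetric] by (simp add: ennreal_minus)
    next
      case False
      then have "ball c R \<subseteq> {z. g z \<le> s}" unfolding sub by auto
      then have "{z\<in>ball c R. s < g z} = {}" by auto
      moreover have "pi * R\<^sup>2 \<le> pi * root m s"
        unfolding t(2)[symmetric] using False R by (intro mult_left_mono power_mono) auto
      ultimately show ?thesis by (simp only: emeasure_empty) (simp add: ennreal_neg)
    qed
  qed
  then show ?thesis
    unfolding nn_integral_minus_root[OF m zero_le_power2 pi_ge_zero, symmetric]
    by (subst layer_cake_sq_modulus) (auto intro!: nn_integral_cong simp: indicator_def)
qed

text \<open>Equality of the integrals makes the superlevel bound sharp for almost all
  \<open>s\<close>. For almost all \<open>s\<close> below \<open>a ^ m\<close> the sublevel set then
  has the full Polya area, which forces a single root, and lies in \<open>K\<close> up to a null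
  set, which for \<open>s\<close> tending to \<open>a ^ m\<close> puts the disc into
  \<open>K\<close>. Equal areas give the reverse inclusion.\<close>

lemma nn_integral_sq_modulus_eq_imp_disc:
  assumes K: "K \<in> sets lebesgue" "emeasure lebesgue K = ennreal (pi * a)" and a: "0 < a"
    and eq: "(\<integral>\<^sup>+z\<in>K. ennreal (g z) \<partial>lebesgue) = ennreal pi * ennreal (a ^ Suc m / real (Suc m))"
  obtains c where "\<And>i. i < m \<Longrightarrow> r i = c" "ae_disc K c (sqrt a)"
proof -
  let ?h = "\<lambda>s. ennreal (pi * a - pi * root m s) * indicator {0<..} s"
  let ?f = "\<lambda>s. emeasure lebesgue {z\<in>K. s < g z} * indicator {0<..} s"
  have h: "(\<integral>\<^sup>+s. ?h s \<partial>lborel) = ennreal pi * ennreal (a ^ Suc m / real (Suc m))"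
    using nn_integral_minus_root[OF m _ pi_ge_zero] a by simp
  have "AE s in lborel. ?f s = ?h s"
  proof (rule AE_eq_of_le_of_nn_integral_eq)
    show "?f \<in> borel_measurable lborel"
      by (rule borel_measurable_emeasure_superlevel[OF sigma_finite_lebesgue measurable_sq_modulus K(1)])
    show "?h \<in> borel_measurable lborel"
      by (auto intro!: borel_measurable_continuous_onI continuous_intros m)
    show "?h s \<le> ?f s" for s
      using emeasure_superlevel_ge[OF K, of s] by (auto simp: indicator_def)
    show "(\<integral>\<^sup>+s. ?f s \<partial>lborel) = (\<integral>\<^sup>+s. ?h s \<partial>lborel)"
      unfolding h using eq layer_cake_sq_modulus[OF K(1)] by simp
    show "(\<integral>\<^sup>+s. ?h s \<partial>lborel) \<noteq> \<infinity>"
      unfolding h by (simp add: ennreal_mult'[symmetric])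
  qed
  then have good: "AE s in lborel. 0 < s \<longrightarrow> s < a ^ m \<longrightarrow>
      emeasure lebesgue {z. g z \<le> s} = ennreal (pi * root m s) \<and> {z. g z \<le> s} - K \<in> null_sets lebesgue"
  proof eventually_elim
    case (elim s)
    show ?case
    proof (intro impI)
      assume s: "0 < s" "s < a ^ m"
      let ?E = "{z. g z \<le> s}"
      have E: "?E \<in> sets lebesgue" by (rule sets_sublevel)
      \<comment> \<open>Below \<open>a ^ m\<close> the difference
        \<open>pi * a - pi * root m s\<close> is not truncated, so it determines the area of
        \<open>K \<inter> ?E\<close>.\<close>
      have "root m s < root m (a ^ m)" using s m by (subst real_root_less_iff) auto
      then have rs: "0 \<le> root m s" "root m s < a" using s m a by (simp_all add: real_root_power_cancel)
      have f: "emeasure lebesgue {z\<in>K. s < g z} = ennreal (pi * a - pi * root m s)"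
        using elim s by simp
      have "emeasure lebesgue (K \<inter> ?E) + ennreal (pi * a - pi * root m s) = ennreal (pi * a)"
        using emeasure_split_level[OF K(1), of s] f K(2) by simp
      then have "emeasure lebesgue (K \<inter> ?E) = ennreal (pi * a) - ennreal (pi * a - pi * root m s)"
        by (metis ennreal_add_diff_cancel_right ennreal_neq_top infinity_ennreal_def)
      also have "\<dots> = ennreal (pi * root m s)" using rs by (subst ennreal_minus) auto
      finally have KE: "emeasure lebesgue (K \<inter> ?E) = ennreal (pi * root m s)" .
      have split: "emeasure lebesgue ?E = emeasure lebesgue (K \<inter> ?E) + emeasure lebesgue (?E - K)"
      proof -
        have "emeasure lebesgue (K \<inter> ?E) + emeasure lebesgue (?E - K) = emeasure lebesgue (K \<inter> ?E \<union> (?E - K))"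
          by (rule plus_emeasure) (use E K(1) in auto)
        also have "K \<inter> ?E \<union> (?E - K) = ?E" by auto
        finally show ?thesis by (rule sym)
      qed
      have le: "emeasure lebesgue ?E \<le> ennreal (pi * root m s)" using s by (intro emeasure_sublevel_le) auto
      \<comment> \<open>\<open>K \<inter> ?E\<close> already has the largest area that
        \<open>?E\<close> can have, so nothing but a null set remains outside
        \<open>K\<close>.\<close>
      have "ennreal (pi * root m s) + emeasure lebesgue (?E - K) \<le> ennreal (pi * root m s) + 0"
        using le unfolding split KE by simp
      then have 0: "emeasure lebesgue (?E - K) = 0"
        by (subst (asm) ennreal_add_left_cancel_le) auto
      with split KE E K(1) show "emeasure lebesgue ?E = ennreal (pi * root m s) \<and> ?E - K \<in> null_sets lebesgue"
        by (auto intro: null_setsI)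
    qed
  qed
  have am: "0 < a ^ m" using a by simp
  define c where "c = r 0"
  have root: "r i = c" if im: "i < m" for i
  proof (rule ccontr)
    assume ne: "r i \<noteq> c"
    \<comment> \<open>Two different roots would make the area bound strict for all small
      \<open>s\<close>, against its sharpness at almost all of them.\<close>
    obtain \<epsilon> where "0 < \<epsilon>" and \<epsilon>: "\<And>s. 0 < s \<Longrightarrow> s < \<epsilon> \<Longrightarrow> emeasure lebesgue {z. g z \<le> s} < ennreal (pi * root m s)"
      unfolding g_def by (rule lemniscate_area_less[where r = r and m = m and ?i0.0 = i and ?j0.0 = 0]) (use im ne m c_def in auto)
    then obtain s where "0 < s" "s < min \<epsilon> (a ^ m)"
        "0 < s \<longrightarrow> s < a ^ m \<longrightarrow> emeasure lebesgue {z. g z \<le> s} = ennreal (pi * root m s) \<and> {z. g z \<le> s} - K \<in> null_sets lebesgue"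
      using AE_lborel_ex_in_interval[OF good, of 0 "min \<epsilon> (a ^ m)"] am by auto
    then show False using \<epsilon>[of s] by auto
  qed
  \<comment> \<open>Only almost every \<open>s\<close> is available, so a sequence of good levels is
    picked between bounds that increase to \<open>a ^ m\<close>; a countable union then keeps the
    exceptional set null.\<close>
  have "\<exists>s. a ^ m * (1 - 1 / real (Suc k)) < s \<and> s < a ^ m \<and> 0 < s \<and> {z. g z \<le> s} - K \<in> null_sets lebesgue" for k
  proof -
    have "0 \<le> 1 - 1 / real (Suc k)" by simp
    then have "0 \<le> a ^ m * (1 - 1 / real (Suc k))" using am by (intro mult_nonneg_nonneg) auto
    moreover have "a ^ m * (1 - 1 / real (Suc k)) < a ^ m" using am by (simp add: algebra_simps)
    ultimately show ?thesis by (rule_tac AE_lborel_ex_in_interval[OF good]) auto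
  qed
  then obtain s where s: "\<And>k. a ^ m * (1 - 1 / real (Suc k)) < s k" "\<And>k. s k < a ^ m" "\<And>k. 0 < s k"
      "\<And>k. {z. g z \<le> s k} - K \<in> null_sets lebesgue" by metis
  have "{z. g z < a ^ m} - K \<subseteq> (\<Union>k. {z. g z \<le> s k} - K)"
  proof safe
    fix z assume z: "g z < a ^ m" "z \<notin> K"
    have "(\<lambda>k. a ^ m * (1 - 1 / real (Suc k))) \<longlonglongrightarrow> a ^ m * (1 - 0)"
      using LIMSEQ_inverse_real_of_nat by (intro tendsto_intros) (simp add: inverse_eq_divide)
    then have "\<forall>\<^sub>F k in sequentially. g z < a ^ m * (1 - 1 / real (Suc k))"
      using z(1) by (intro order_tendstoD) auto
    then obtain k where "g z < a ^ m * (1 - 1 / real (Suc k))" using eventually_happens'[OF sequentially_bot] by blast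
    then have "g z \<le> s k" using s(1)[of k] by simp
    with z show "z \<in> (\<Union>k. {z. g z \<le> s k} - K)" by auto
  qed
  moreover have "{z. g z < a ^ m} = ball c (sqrt a)"
  proof -
    have "((dist c z)\<^sup>2) ^ m < a ^ m \<longleftrightarrow> dist c z < sqrt a" for z
    proof -
      have "((dist c z)\<^sup>2) ^ m < a ^ m \<longleftrightarrow> (dist c z)\<^sup>2 < a"
        unfolding not_le[symmetric] using m a by (subst power_mono_iff) auto
      also have "\<dots> \<longleftrightarrow> dist c z < sqrt a"
        using real_sqrt_less_iff[of "(dist c z)\<^sup>2" a] by simp
      finally show ?thesis .
    qed
    then show ?thesis using sq_modulus_single_root[OF root] by auto
  qed
  moreover have "(\<Union>k. {z. g z \<le> s k} - K) \<in> null_sets lebesgue"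
    using s(4) by (intro null_sets_UN) auto
  ultimately have BK: "ball c (sqrt a) - K \<in> null_sets lebesgue"
    using K(1) by (metis completion.complete_sets_sandwich null_sets_completion_subset)
  have "emeasure lebesgue (ball c (sqrt a) \<inter> K) = ennreal (pi * a)"
  proof -
    have "emeasure lebesgue (ball c (sqrt a)) = ennreal (pi * a)"
      using a by (simp only: emeasure_lebesgue_ball_complex real_sqrt_ge_zero less_imp_le) simp
    moreover have "emeasure lebesgue (ball c (sqrt a) - (ball c (sqrt a) - K)) = emeasure lebesgue (ball c (sqrt a))"
      by (rule emeasure_Diff_null_set[OF BK]) auto
    moreover have "ball c (sqrt a) - (ball c (sqrt a) - K) = ball c (sqrt a) \<inter> K" by auto
    ultimately show ?thesis by simp
  qed
  \<comment> \<open>\<open>K\<close> and its part inside the disc have the same finite area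
    \<open>pi * a\<close>.\<close>
  moreover have "emeasure lebesgue (K - ball c (sqrt a) \<inter> K) = emeasure lebesgue K - emeasure lebesgue (ball c (sqrt a) \<inter> K)"
    using K calculation by (intro emeasure_Diff) auto
  ultimately have "emeasure lebesgue (K - ball c (sqrt a) \<inter> K) = 0"
    using K(2) by simp
  then have "K - ball c (sqrt a) \<inter> K \<in> null_sets lebesgue"
    using K(1) by (intro null_setsI sets.Diff sets.Int) auto
  moreover have "K - ball c (sqrt a) \<inter> K = K - ball c (sqrt a)" by auto
  ultimately have "sym_diff K (ball c (sqrt a)) \<in> null_sets lebesgue"
    using BK by auto
  then have "ae_disc K c (sqrt a)" using a by (simp add: ae_disc_def)
  with root show ?thesis by (rule that)
qed

end

section \<open>Application to the derivative of a monic polynomial\<close>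

lemma ae_disc_AE: "ae_disc K c R \<Longrightarrow> AE z in lebesgue. z \<in> K \<longleftrightarrow> z \<in> ball c R"
  unfolding ae_disc_def by (rule AE_I'[of "sym_diff K (ball c R)"]) auto

text \<open>The equality clause concerns \<open>2 \<le> n\<close> and positive finite area: for
  \<open>n = 1\<close> both sides are the area of \<open>K\<close>, and for \<open>n \<ge> 2\<close>
  and null or infinite area both sides are 0 or infinite, whatever the shape of
  \<open>K\<close>.\<close>

theorem theorem3:
  fixes p :: "complex poly" and n :: nat and K :: "complex set"
  assumes "lead_coeff p = 1" and "degree p = n" and "K \<in> sets lebesgue"
  shows "(\<integral>\<^sup>+ z. of_nat (preimage_mult z p K) \<partial>lebesgue)
           = (\<integral>\<^sup>+ z\<in>K. ennreal ((cmod (poly (pderiv p) z))\<^sup>2) \<partial>lebesgue)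
       \<and> (\<integral>\<^sup>+ z\<in>K. ennreal ((cmod (poly (pderiv p) z))\<^sup>2) \<partial>lebesgue)
           \<ge> of_nat n * ennreal pi * (emeasure lebesgue K / ennreal pi) ^ n
       \<and> (2 \<le> n \<and> 0 < emeasure lebesgue K \<and> emeasure lebesgue K < \<infinity> \<longrightarrow>
            ((\<integral>\<^sup>+ z\<in>K. ennreal ((cmod (poly (pderiv p) z))\<^sup>2) \<partial>lebesgue)
               = of_nat n * ennreal pi * (emeasure lebesgue K / ennreal pi) ^ n
             \<longleftrightarrow> (\<exists>c r. ae_disc K c r \<and> critical_points p = {c})))"
proof -
  let ?I = "\<integral>\<^sup>+ z\<in>K. ennreal ((cmod (poly (pderiv p) z))\<^sup>2) \<partial>lebesgue"
  let ?R = "of_nat n * ennreal pi * (emeasure lebesgue K / ennreal pi) ^ n"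
  have K: "K \<in> sets lebesgue" by fact
  note area_formula = nn_integral_preimage_mult[OF K, of p]
  consider "n = 0" | "n = 1" | "2 \<le> n" by linarith
  then show ?thesis
  proof cases
    case 1
    then show ?thesis using area_formula by simp
  next
    case 2
    then have "degree (pderiv p) = 0" "coeff (pderiv p) 0 = 1"
      using assms(1,2) by (simp_all add: degree_pderiv coeff_pderiv)
    then have "pderiv p = 1" by (metis degree_eq_zeroE coeff_pCons_0 one_pCons)
    then have I: "?I = emeasure lebesgue K"
      using K by simp
    have "?R = emeasure lebesgue K"
      using 2 by (simp add: ennreal_times_divide mult.commute[of "ennreal pi"] mult_divide_eq_ennreal)
    with I 2 area_formula show ?thesis by simp
  next
    case 3
    define m where "m = n - 1"
    have m: "0 < m" and n: "n = Suc m" using 3 by (simp_all add: m_def)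
    have deg: "degree (pderiv p) = m" using assms(2) by (simp add: degree_pderiv m_def)
    have lead: "lead_coeff (pderiv p) = of_nat n"
      using assms(1,2) unfolding deg coeff_pderiv by (simp add: n)
    \<comment> \<open>Over the complex numbers \<open>pderiv p\<close> splits into linear factors:
      it is \<open>n\<close> times a monic product over its \<open>m\<close> roots.\<close>
    obtain r where r: "smult (lead_coeff (pderiv p)) (\<Prod>i<degree (pderiv p). [:- r i, 1:]) = pderiv p"
      by (rule complex_poly_decompose')
    have dp: "poly (pderiv p) z = of_nat n * (\<Prod>i<m. z - r i)" for z
      by (subst r[unfolded lead, unfolded deg, symmetric]) (simp add: poly_prod)
    let ?g = "\<lambda>z. (cmod (\<Prod>i<m. z - r i))\<^sup>2"
    let ?J = "\<lambda>K. \<integral>\<^sup>+z\<in>K. ennreal (?g z) \<partial>lebesgue"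
    have gm: "?g \<in> borel_measurable lebesgue" by (rule measurable_sq_modulus[OF m])
    have I: "?I = ennreal ((real n)\<^sup>2) * ?J K"
    proof -
      have "?I = (\<integral>\<^sup>+z. ennreal ((real n)\<^sup>2) * (ennreal (?g z) * indicator K z) \<partial>lebesgue)"
        by (intro nn_integral_cong) (simp add: dp norm_mult power_mult_distrib ennreal_mult mult.assoc)
      also have "\<dots> = ennreal ((real n)\<^sup>2) * ?J K"
        by (intro nn_integral_cmult borel_measurable_times_ennreal borel_measurable_indicator
            measurable_compose[OF gm measurable_ennreal] K)
      finally show ?thesis .
    qed
    have crit: "critical_points p = {z. \<exists>i<m. z = r i}"
      using n by (auto simp: critical_points_def dp simp del: of_nat_Suc)
    show ?thesis
    proof (cases "emeasure lebesgue K = \<infinity>")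
      case True
      have "?J K = \<infinity>" by (rule nn_integral_sq_modulus_infinite[OF m K True])
      then have "?I = \<infinity>" unfolding I using n by (simp add: ennreal_mult_top)
      with True area_formula show ?thesis by simp
    next
      case False
      \<comment> \<open>The squared radius of a disc with the area of \<open>K\<close>.\<close>
      define a where "a = measure lebesgue K / pi"
      have a: "0 \<le> a" by (simp add: a_def)
      have Ka: "emeasure lebesgue K = ennreal (pi * a)"
        using False by (simp add: a_def emeasure_eq_ennreal_measure)
      \<comment> \<open>Since \<open>n = m + 1\<close>, the bound \<open>n * pi * a ^ n\<close> is
        \<open>n^2\<close> times this value, matching the factor \<open>n^2\<close> in
        \<open>?I\<close>.\<close>
      let ?V = "ennreal pi * ennreal (a ^ Suc m / real (Suc m))"
      have R: "?R = ennreal ((real n)\<^sup>2) * ?V"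
      proof -
        have "emeasure lebesgue K / ennreal pi = ennreal a"
          unfolding Ka using a by (subst divide_ennreal) auto
        then have "?R = ennreal (real n * pi * a ^ n)"
          using a by (simp add: ennreal_of_nat_eq_real_of_nat ennreal_power ennreal_mult)
        also have "real n * pi * a ^ n = (real n)\<^sup>2 * (pi * (a ^ Suc m / real (Suc m)))"
          by (simp add: n power2_eq_square del: of_nat_Suc)
        finally show ?thesis using a by (simp only: ennreal_mult' zero_le_power2 pi_ge_zero)
      qed
      have le: "?R \<le> ?I"
        unfolding R I by (intro mult_left_mono nn_integral_sq_modulus_ge[OF m K Ka a]) auto
      have "?I = ?R \<longleftrightarrow> ?J K = ?V"
        unfolding R I using n by (subst ennreal_mult_cancel_left) auto
      also have "\<dots> \<longleftrightarrow> (\<exists>c r. ae_disc K c r \<and> critical_points p = {c})" if "0 < emeasure lebesgue K"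
      proof
        assume eq: "?J K = ?V"
        have "0 < a" using that unfolding Ka by (simp add: zero_less_mult_iff)
        obtain c where c: "\<And>i. i < m \<Longrightarrow> r i = c" "ae_disc K c (sqrt a)"
          using nn_integral_sq_modulus_eq_imp_disc[OF m K Ka \<open>0 < a\<close> eq] by metis
        then have "critical_points p = {c}" unfolding crit using m by auto
        with c show "\<exists>c r. ae_disc K c r \<and> critical_points p = {c}" by blast
      next
        assume "\<exists>c r. ae_disc K c r \<and> critical_points p = {c}"
        then obtain c \<rho> where c: "ae_disc K c \<rho>" "critical_points p = {c}" by blast
        have \<rho>: "0 \<le> \<rho>" using c(1) by (simp add: ae_disc_def)
        have roots: "r i = c" if "i < m" for i using c(2) that unfolding crit by blast
        note ae = ae_disc_AE[OF c(1)]
        have "emeasure lebesgue K = emeasure lebesgue (ball c \<rho>)"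
          by (rule emeasure_eq_AE[OF ae K]) auto
        then have "a = \<rho>\<^sup>2"
          unfolding Ka emeasure_lebesgue_ball_complex[OF \<rho>] using a by simp
        \<comment> \<open>Altering \<open>K\<close> by a null set does not change the integral, so
          the exact value for the disc applies.\<close>
        have "?J K = ?J (ball c \<rho>)"
          by (rule nn_integral_cong_AE) (use ae in \<open>eventually_elim, auto simp: indicator_def\<close>)
        also have "\<dots> = ?V"
          unfolding \<open>a = \<rho>\<^sup>2\<close> by (rule nn_integral_sq_modulus_disc[OF m roots \<rho>])
        finally show "?J K = ?V" .
      qed
      finally show ?thesis using area_formula le by auto
    qed
  qed
qed

end
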